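(* Let $\mathcal N$ be an NDCS network with sources $S_1,\dots,S_m$ and parties $A_1,\dots,A_n$, and let $p(a_1,\dots,a_n)$ be the output distribution of a causally consistent model on $\mathcal N$ (finite output alphabets). For each $i$ let $f_i$ be an arbitrary complex-valued function of the output $a_i$ of $A_i$. Then the covariance matrix $\mathcal C(f_1,\dots,f_n)$ admits an $\mathcal N$-compatible matrix decomposition.
   Context: A network $\mathcal N$ is a bipartite graph between sources $S_\alpha$ ($\alpha=1,\dots,m$) and parties $A_i$ ($i=1,\dots,n$); $\alpha\to i$ means $S_\alpha$ is adjacent to $A_i$. Every source has at least one adjacent party, every party has at least one adjacent source, and no two sources have comparable (under inclusion) sets of adjacent parties. $\mathcal N$ is NDCS (no double common-source) if any two distinct parties have at most one common adjacent source. Covariance matrix: for complex functions $f_i(a_i)$ and a joint distribution $p$ of outputs, $\mathcal C=\mathcal C(f_1,\dots,f_n)$ is the $n\times n$ matrix with $\mathcal C_{ij}=\mathbb E[\bar f_i f_j]-\mathbb E[\bar f_i]\,\mathbb E[f_j]$. $\mathcal N$-compatible matrix decomposition: for each source $\alpha$, let $\mathcal L_\alpha$ be the set of $n\times n$ complex positive semidefinite matrices $M_\alpha$ with $(M_\alpha)_{ij}\neq 0$ only if $\alpha\to i$ and $\alpha\to j$. A positive semidefinite $n\times n$ matrix $M$ admits an $\mathcal N$-compatible matrix decomposition if $M=\sum_\alpha M_\alpha$ with $M_\alpha\in\mathcal L_\alpha$ for all $\alpha$. Non-fanout inflation of order $d\ge 2$: choose, for every pair $(\alpha,i)$ with $\alpha\to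 i$, a permutation $\pi_i^\alpha$ of $\{1,\dots,d\}$. The inflated network $\widetilde{\mathcal N}$ has parties $A_i^{(k)}$ and sources $S_\alpha^{(k)}$ ($1\le k\le d$), with $S_\alpha^{(k)}$ adjacent to $A_i^{((\pi_i^\alpha)^{-1}(k))}$ whenever $\alpha\to i$, and no other adjacencies. Causally consistent model on $\mathcal N$ (this formalizes "signals and measurements in an arbitrary physical theory obeying causality / no-signaling and independence, where sources and parties can be independently and identically copied"): a joint distribution $p(a_1,\dots,a_n)$ of the outputs of $\mathcal N$ together with, for every non-fanout inflation $\widetilde{\mathcal N}$ of every order $d\ge2$, a joint distribution of the outputs $a_i^{(k)}$ of its parties, such that: (C0) if $A_i\neq A_j$ share no source in $\mathcal N$, then $p(a_i,a_j)=p(a_i)p(a_j)$; (C1) in every inflation, each $a_i^{(k)}$ has marginal distribution $p(a_i)$, and if $A_i^{(k)}$ and $A_j^{(l)}$ with $i\neq j$ share a source in $\widetilde{\mathcal N}$, then the joint distribution of $(a_i^{(k)},a_j^{(l)})$ equals $p(a_i,a_j)$; (C2) in every inflation, if two distinct parties share no source, the joint distribution of their outputs factorizes into the product of their marginals. *)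

theory Defs
  imports "HOL-Probability.Probability"
begin

text \<open>Conventions. Parties are indexed by 0..<n, sources by 0..<m (0-based).
  adj al i means that source al is adjacent to party i.
  Outputs of all parties take values in a common finite alphabet (a finite type).
  Joint distributions are pmfs over output assignments; only the coordinates
  of actual parties are relevant.\<close>

definition network :: "nat \<Rightarrow> nat \<Rightarrow> (nat \<Rightarrow> nat \<Rightarrow> bool) \<Rightarrow> bool" where
  "network m n adj \<longleftrightarrow>
     (\<forall>al<m. \<exists>i<n. adj al i) \<and>
     (\<forall>i<n. \<exists>al<m. adj al i) \<and>
     (\<forall>al<m. \<forall>be<m. al \<noteq> be \<longrightarrow>
        \<not> ({i. i < n \<and> adj al i} \<subseteq> {i. i < n \<and> adj be i}))"

definition NDCS :: "nat \<Rightarrow> nat \<Rightarrow> (nat \<Rightarrow> nat \<Rightarrow> bool) \<Rightarrow> bool" where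
  "NDCS m n adj \<longleftrightarrow> network m n adj \<and>
     (\<forall>i<n. \<forall>j<n. i \<noteq> j \<longrightarrow> card {al. al < m \<and> adj al i \<and> adj al j} \<le> 1)"

definition indep_pair :: "'b pmf \<Rightarrow> ('b \<Rightarrow> 'a) \<Rightarrow> ('b \<Rightarrow> 'a) \<Rightarrow> bool" where
  "indep_pair q X Y \<longleftrightarrow>
     map_pmf (\<lambda>x. (X x, Y x)) q = pair_pmf (map_pmf X q) (map_pmf Y q)"

text \<open>Valid choice of permutations for a non-fanout inflation of order d:
  prm al i is a permutation of {0..<d} whenever al is adjacent to i.\<close>
definition valid_perms :: "nat \<Rightarrow> nat \<Rightarrow> (nat \<Rightarrow> nat \<Rightarrow> bool) \<Rightarrow> nat \<Rightarrow>
    (nat \<Rightarrow> nat \<Rightarrow> nat \<Rightarrow> nat) \<Rightarrow> bool" where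
  "valid_perms m n adj d prm \<longleftrightarrow>
     (\<forall>al<m. \<forall>i<n. adj al i \<longrightarrow> bij_betw (prm al i) {..<d} {..<d})"

text \<open>In the inflation, source copy S_al^(k) is adjacent to party copy A_i^(l) iff
  adj al i and prm al i l = k (i.e. l = (prm al i)^{-1} k). Hence the party copies
  (i,k) and (j,l) share a source iff the following holds.\<close>
definition infl_share :: "nat \<Rightarrow> (nat \<Rightarrow> nat \<Rightarrow> bool) \<Rightarrow> (nat \<Rightarrow> nat \<Rightarrow> nat \<Rightarrow> nat) \<Rightarrow>
    nat \<times> nat \<Rightarrow> nat \<times> nat \<Rightarrow> bool" where
  "infl_share m adj prm u v \<longleftrightarrow>
     (\<exists>al<m. adj al (fst u) \<and> adj al (fst v) \<and> prm al (fst u) (snd u) = prm al (fst v) (snd v))"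

definition causally_consistent ::
  "nat \<Rightarrow> nat \<Rightarrow> (nat \<Rightarrow> nat \<Rightarrow> bool) \<Rightarrow> (nat \<Rightarrow> 'a) pmf \<Rightarrow>
   (nat \<Rightarrow> (nat \<Rightarrow> nat \<Rightarrow> nat \<Rightarrow> nat) \<Rightarrow> ((nat \<times> nat) \<Rightarrow> 'a) pmf) \<Rightarrow> bool" where
  "causally_consistent m n adj p Q \<longleftrightarrow>
     \<comment> \<open>C0\<close>
     (\<forall>i<n. \<forall>j<n. i \<noteq> j \<longrightarrow> \<not> (\<exists>al<m. adj al i \<and> adj al j) \<longrightarrow>
        indep_pair p (\<lambda>x. x i) (\<lambda>x. x j)) \<and>
     (\<forall>d\<ge>2. \<forall>prm. valid_perms m n adj d prm \<longrightarrow>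
       \<comment> \<open>C1\<close>
       (\<forall>i<n. \<forall>k<d. map_pmf (\<lambda>y. y (i, k)) (Q d prm) = map_pmf (\<lambda>x. x i) p) \<and>
       (\<forall>i<n. \<forall>j<n. \<forall>k<d. \<forall>l<d. i \<noteq> j \<longrightarrow> infl_share m adj prm (i, k) (j, l) \<longrightarrow>
          map_pmf (\<lambda>y. (y (i, k), y (j, l))) (Q d prm) = map_pmf (\<lambda>x. (x i, x j)) p) \<and>
       \<comment> \<open>C2\<close>
       (\<forall>i<n. \<forall>j<n. \<forall>k<d. \<forall>l<d. (i, k) \<noteq> (j, l) \<longrightarrow> \<not> infl_share m adj prm (i, k) (j, l) \<longrightarrow>
          indep_pair (Q d prm) (\<lambda>y. y (i, k)) (\<lambda>y. y (j, l))))"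

definition causally_consistent_distr :: "nat \<Rightarrow> nat \<Rightarrow> (nat \<Rightarrow> nat \<Rightarrow> bool) \<Rightarrow> (nat \<Rightarrow> 'a) pmf \<Rightarrow> bool" where
  "causally_consistent_distr m n adj p \<longleftrightarrow> (\<exists>Q. causally_consistent m n adj p Q)"

definition cov_matrix :: "(nat \<Rightarrow> 'a) pmf \<Rightarrow> (nat \<Rightarrow> 'a \<Rightarrow> complex) \<Rightarrow> nat \<Rightarrow> nat \<Rightarrow> complex" where
  "cov_matrix p f i j =
     measure_pmf.expectation p (\<lambda>x. cnj (f i (x i)) * f j (x j))
     - cnj (measure_pmf.expectation p (\<lambda>x. f i (x i))) * measure_pmf.expectation p (\<lambda>x. f j (x j))"

definition psd :: "nat \<Rightarrow> (nat \<Rightarrow> nat \<Rightarrow> complex) \<Rightarrow> bool" where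
  "psd n M \<longleftrightarrow> (\<forall>v :: nat \<Rightarrow> complex.
     (\<Sum>i<n. \<Sum>j<n. cnj (v i) * M i j * v j) \<in> \<real> \<and>
     Re (\<Sum>i<n. \<Sum>j<n. cnj (v i) * M i j * v j) \<ge> 0)"

definition N_compatible_decomp :: "nat \<Rightarrow> nat \<Rightarrow> (nat \<Rightarrow> nat \<Rightarrow> bool) \<Rightarrow> (nat \<Rightarrow> nat \<Rightarrow> complex) \<Rightarrow> bool" where
  "N_compatible_decomp m n adj M \<longleftrightarrow>
     (\<exists>Ms :: nat \<Rightarrow> nat \<Rightarrow> nat \<Rightarrow> complex.
        (\<forall>al<m. psd n (Ms al) \<and>
           (\<forall>i<n. \<forall>j<n. Ms al i j \<noteq> 0 \<longrightarrow> adj al i \<and> adj al j)) \<and>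
        (\<forall>i<n. \<forall>j<n. M i j = (\<Sum>al<m. Ms al i j)))"

end

theory Submission
  imports Defs
begin

text \<open>
  By duality it suffices to pair the covariance matrix \<open>C\<close> with Hermitian matrices \<open>T\<^sub>\<alpha>\<close>, positive
  semidefinite on the parties of \<open>\<alpha>\<close>, whose diagonal entries \<open>y\<^sub>i\<close> do not depend on \<open>\<alpha>\<close>, and to show
  that the total pairing is nonnegative. The covariance matrix of an inflation is positive
  semidefinite, which says \<open>\<Sum>\<^sub>i\<^sub>j C\<^sub>i\<^sub>j \<langle>P\<^sub>i\<^sup>\<alpha> v\<^sub>i, P\<^sub>j\<^sup>\<alpha> v\<^sub>j\<rangle> \<ge> 0\<close> for all permutation matrices \<open>P\<^sub>i\<^sup>\<alpha>\<close>
  and vectors \<open>v\<^sub>i\<close>, where \<open>\<alpha>\<close> is the unique common source of \<open>i\<close> and \<open>j\<close>. Writing \<open>T\<^sub>\<alpha>\<close> as a Gram matrix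
  of vectors \<open>u\<^sub>i\<^sup>\<alpha>\<close>, one chooses \<open>v\<^sub>i\<close> to be an embezzling vector \<open>w\<close>, for which \<open>u\<^sub>i\<^sup>\<alpha> \<otimes> w\<close> is, up to a
  vanishing error, a permutation of \<open>\<surd>y\<^sub>i w\<close> for all \<open>\<alpha>\<close> at once; this reproduces all the matrices
  \<open>T\<^sub>\<alpha>\<close> in the limit. In place of a separation theorem, the distance between \<open>C\<close> and the decomposable
  matrices is minimised directly, and the \<open>T\<^sub>\<alpha>\<close> are read off from the first-order conditions.
\<close>

subsection \<open>Covariances in inflations\<close>

definition cov :: "'b pmf \<Rightarrow> ('b \<Rightarrow> complex) \<Rightarrow> ('b \<Rightarrow> complex) \<Rightarrow> complex" where
  "cov q X Y = measure_pmf.expectation q (\<lambda>x. cnj (X x) * Y x)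
     - cnj (measure_pmf.expectation q X) * measure_pmf.expectation q Y"

lemma cov_matrix_eq_cov: "cov_matrix p f i j = cov p (\<lambda>x. f i (x i)) (\<lambda>x. f j (x j))"
  by (simp add: cov_matrix_def cov_def)

lemma cov_map_pmf: "cov (map_pmf h q) X Y = cov q (X \<circ> h) (Y \<circ> h)"
  by (simp add: cov_def o_def)

lemma integrable_pmf_finite_range:
  fixes X :: "'b \<Rightarrow> complex"
  assumes "finite (range X)"
  shows "integrable (measure_pmf q) X"
proof -
  have "bounded (range X)" using assms by (rule finite_imp_bounded)
  then obtain B where "\<forall>x. norm (X x) \<le> B" by (auto simp: bounded_iff)
  then show ?thesis
    by (intro measure_pmf.integrable_const_bound[where B=B]) auto
qed

text \<open>Covariance is the expected product of the centred variables, so the quadratic form is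
  the variance of a linear combination. This yields positivity both for \<open>p\<close> itself and
  for the outputs of an inflation.\<close>

lemma cov_quad_form:
  fixes X :: "'c \<Rightarrow> 'b \<Rightarrow> complex" and v :: "'c \<Rightarrow> complex"
  assumes fin: "\<And>a. a \<in> A \<Longrightarrow> finite (range (X a))"
  shows "(\<Sum>a\<in>A. \<Sum>b\<in>A. cnj (v a) * cov q (X a) (X b) * v b)
      = of_real (measure_pmf.expectation q
          (\<lambda>x. (cmod (\<Sum>b\<in>A. v b * (X b x - measure_pmf.expectation q (X b))))\<^sup>2))"
proof -
  define e where "e b = measure_pmf.expectation q (X b)" for b
  have int: "integrable (measure_pmf q) (X a)" if "a \<in> A" for a
    using fin[OF that] by (rule integrable_pmf_finite_range)
  have int2: "integrable (measure_pmf q) (\<lambda>x. cnj (X a x) * X b x)" if "a \<in> A" "b \<in> A" for a b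
  proof (rule integrable_pmf_finite_range)
    have "range (\<lambda>x. cnj (X a x) * X b x) \<subseteq> (\<lambda>(s,t). cnj s * t) ` (range (X a) \<times> range (X b))"
      by auto
    then show "finite (range (\<lambda>x. cnj (X a x) * X b x))"
      using fin that by (meson finite_SigmaI finite_imageI finite_subset)
  qed
  have c: "cov q (X a) (X b) = measure_pmf.expectation q (\<lambda>x. cnj (X a x - e a) * (X b x - e b))"
    if "a \<in> A" "b \<in> A" for a b
  proof -
    have "measure_pmf.expectation q (\<lambda>x. cnj (X a x - e a) * (X b x - e b))
      = measure_pmf.expectation q (\<lambda>x. cnj (X a x) * X b x - cnj (X a x) * e b - cnj (e a) * X b x + cnj (e a) * e b)"
      by (simp add: algebra_simps)
    also have "\<dots> = cov q (X a) (X b)"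
      using int[OF that(1)] int[OF that(2)] int2[OF that]
      by (simp add: cov_def e_def)
    finally show ?thesis by simp
  qed
  have int3: "integrable (measure_pmf q) (\<lambda>x. cnj (X a x - e a) * (X b x - e b))"
    if "a \<in> A" "b \<in> A" for a b
    using int[OF that(1)] int[OF that(2)] int2[OF that] by (simp add: algebra_simps)
  have "(\<Sum>a\<in>A. \<Sum>b\<in>A. cnj (v a) * cov q (X a) (X b) * v b)
      = (\<Sum>a\<in>A. \<Sum>b\<in>A. measure_pmf.expectation q (\<lambda>x. cnj (v a) * (cnj (X a x - e a) * (X b x - e b)) * v b))"
    by (intro sum.cong refl) (simp add: c)
  also have "\<dots> = measure_pmf.expectation q (\<lambda>x. \<Sum>a\<in>A. \<Sum>b\<in>A. cnj (v a) * (cnj (X a x - e a) * (X b x - e b)) * v b)"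
    using int3 by (simp add: Bochner_Integration.integral_sum)
  also have "(\<lambda>x. \<Sum>a\<in>A. \<Sum>b\<in>A. cnj (v a) * (cnj (X a x - e a) * (X b x - e b)) * v b)
     = (\<lambda>x. of_real ((cmod (\<Sum>b\<in>A. v b * (X b x - e b)))\<^sup>2))"
    unfolding complex_norm_square by (rule ext, subst sum.swap) (simp add: sum_product mult_ac)
  also have "measure_pmf.expectation q \<dots> = of_real (measure_pmf.expectation q (\<lambda>x. (cmod (\<Sum>b\<in>A. v b * (X b x - e b)))\<^sup>2))"
    by (rule integral_complex_of_real)
  finally show ?thesis by (simp add: e_def)
qed

lemma cov_indep_pair:
  fixes X Y :: "'b \<Rightarrow> 'a::finite"
  assumes "indep_pair q X Y"
  shows "cov q (g \<circ> X) (h \<circ> Y) = 0"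
proof -
  have "measure_pmf.expectation q (\<lambda>x. cnj (g (X x)) * h (Y x))
      = measure_pmf.expectation (map_pmf (\<lambda>x. (X x, Y x)) q) (\<lambda>z. cnj (g (fst z)) * h (snd z))"
    by simp
  also have "\<dots> = measure_pmf.expectation (pair_pmf (map_pmf X q) (map_pmf Y q)) (\<lambda>z. cnj (g (fst z)) * h (snd z))"
    using assms by (simp add: indep_pair_def)
  also have "\<dots> = cnj (measure_pmf.expectation (map_pmf X q) g) * measure_pmf.expectation (map_pmf Y q) h"
  proof -
    have "measure_pmf.expectation (pair_pmf (map_pmf X q) (map_pmf Y q)) (\<lambda>z. cnj (g (fst z)) * h (snd z))
      = (\<Sum>z\<in>UNIV \<times> UNIV. pmf (pair_pmf (map_pmf X q) (map_pmf Y q)) z *\<^sub>R (cnj (g (fst z)) * h (snd z)))"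
      by (rule integral_measure_pmf) auto
    also have "\<dots> = (\<Sum>a\<in>UNIV. \<Sum>b\<in>UNIV. (of_real (pmf (map_pmf X q) a) * cnj (g a)) * (of_real (pmf (map_pmf Y q) b) * h b))"
      unfolding sum.cartesian_product' by (simp add: pmf_pair scaleR_conv_of_real mult_ac del: UNIV_Times_UNIV)
    also have "\<dots> = cnj (\<Sum>a\<in>UNIV. pmf (map_pmf X q) a *\<^sub>R g a) * (\<Sum>b\<in>UNIV. pmf (map_pmf Y q) b *\<^sub>R h b)"
      by (simp add: sum_product scaleR_conv_of_real)
    also have "\<dots> = cnj (measure_pmf.expectation (map_pmf X q) g) * measure_pmf.expectation (map_pmf Y q) h"
      by (simp only: integral_measure_pmf[of UNIV, OF finite_class.finite_UNIV UNIV_I])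
    finally show ?thesis .
  qed
  finally show ?thesis by (simp add: cov_def o_def)
qed

text \<open>The source is part of the index: in an NDCS network it is determined by the pair
  \<open>(i, j)\<close>, so a sum over these triples runs once over the ordered pairs of distinct
  parties with a common source, while each source can still be treated separately.\<close>

definition off_diag :: "nat \<Rightarrow> nat \<Rightarrow> (nat \<Rightarrow> nat \<Rightarrow> bool) \<Rightarrow> (nat \<times> nat \<times> nat) set" where
  "off_diag m n adj = {(al, i, j). al < m \<and> i < n \<and> j < n \<and> i \<noteq> j \<and> adj al i \<and> adj al j}"

lemma finite_off_diag [simp]: "finite (off_diag m n adj)"
  by (rule finite_subset[of _ "{..<m} \<times> {..<n} \<times> {..<n}"]) (auto simp: off_diag_def)

text \<open>\<^term>\<open>s al i k\<close> is the copy of party \<^term>\<open>i\<close> that receives from copy \<^term>\<open>k\<close> of source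
  \<^term>\<open>al\<close>, that is, \<^term>\<open>s al i\<close> is the inverse of the permutation chosen for the inflation.\<close>

locale inflation_form =
  fixes m n :: nat and adj :: "nat \<Rightarrow> nat \<Rightarrow> bool" and C :: "nat \<Rightarrow> nat \<Rightarrow> complex"
  assumes perm_nonneg: "\<And>(d::nat) (s :: nat \<Rightarrow> nat \<Rightarrow> nat \<Rightarrow> nat) (v :: nat \<Rightarrow> nat \<Rightarrow> complex). d \<ge> 2 \<Longrightarrow>
    (\<And>al i. al < m \<Longrightarrow> i < n \<Longrightarrow> adj al i \<Longrightarrow> bij_betw (s al i) {..<d} {..<d}) \<Longrightarrow>
    0 \<le> Re ((\<Sum>i<n. C i i * (\<Sum>k<d. of_real ((cmod (v i k))\<^sup>2)))
      + (\<Sum>(al, i, j)\<in>off_diag m n adj. C i j * (\<Sum>w<d. cnj (v i (s al i w)) * v j (s al j w))))"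

lemma sum_off_diag:
  "(\<Sum>(al, i, j)\<in>off_diag m n adj. g al i j)
    = (\<Sum>i<n. \<Sum>j\<in>{..<n}-{i}. \<Sum>al | al < m \<and> adj al i \<and> adj al j. g al i j)"
proof -
  have "(\<Sum>(al, i, j)\<in>off_diag m n adj. g al i j)
     = (\<Sum>(i, j, al)\<in>(SIGMA i:{..<n}. SIGMA j:{..<n}-{i}. {al. al < m \<and> adj al i \<and> adj al j}). g al i j)"
    by (rule sum.reindex_bij_witness[of _ "\<lambda>(i,j,al). (al,i,j)" "\<lambda>(al,i,j). (i,j,al)"])
      (auto simp: off_diag_def)
  also have "\<dots> = (\<Sum>i<n. \<Sum>j\<in>{..<n}-{i}. \<Sum>al | al < m \<and> adj al i \<and> adj al j. g al i j)"
    by (simp add: sum.Sigma split_def)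
  finally show ?thesis .
qed

text \<open>The covariance matrix of all output copies of an inflation has \<open>C i i\<close> on
  the diagonal, \<open>C i j\<close> where copies of two different parties share a source copy, and
  0 elsewhere. Its quadratic form at \<open>v\<close> is the expression in question. Inflations
  enter the rest of the proof only through this inequality.\<close>

lemma inflation_form_cov_matrix:
  fixes p :: "(nat \<Rightarrow> 'a::finite) pmf" and f :: "nat \<Rightarrow> 'a \<Rightarrow> complex"
  assumes ndcs: "NDCS m n adj" and cc: "causally_consistent_distr m n adj p"
  shows "inflation_form m n adj (cov_matrix p f)"
proof
  fix d :: nat and s :: "nat \<Rightarrow> nat \<Rightarrow> nat \<Rightarrow> nat" and v :: "nat \<Rightarrow> nat \<Rightarrow> complex"
  assume d: "d \<ge> 2"
    and s: "\<And>al i. al < m \<Longrightarrow> i < n \<Longrightarrow> adj al i \<Longrightarrow> bij_betw (s al i) {..<d} {..<d}"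
  define C where "C = cov_matrix p f"
  \<comment> \<open>Inflations are given by maps from party copies to source copies, whereas the
    form is summed over source copies \<open>w\<close>; inverting \<open>s\<close> passes from one
    to the other.\<close>
  define prm where "prm al i = inv_into {..<d} (s al i)" for al i
  define sh where "sh i j = {al. al < m \<and> adj al i \<and> adj al j}" for i j
  obtain Q where Q: "causally_consistent m n adj p Q"
    using cc by (auto simp: causally_consistent_distr_def)
  define q where "q = Q d prm"
  have prm_s: "prm al i (s al i w) = w" if "al < m" "i < n" "adj al i" "w < d" for al i w
    using bij_betw_inv_into_left[OF s[OF that(1-3)]] that by (simp add: prm_def)
  have vp: "valid_perms m n adj d prm"
    using s by (simp add: valid_perms_def prm_def bij_betw_inv_into)
  have prm_inj: "k = l" if "al < m" "i < n" "adj al i" "k < d" "l < d" "prm al i k = prm al i l" for al i k l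
    using vp that unfolding valid_perms_def bij_betw_def inj_on_def by auto
  have fsh: "finite (sh i j)" for i j
    by (simp add: sh_def)
  define X where "X = (\<lambda>a (y :: nat \<times> nat \<Rightarrow> 'a). f (fst a) (y a))"
  note consistent = Q[unfolded causally_consistent_def, THEN conjunct2, THEN spec, THEN mp, OF d, THEN spec, THEN mp, OF vp,
    folded q_def]
  note C1_single = consistent[THEN conjunct1, rule_format]
    and C1_pair = consistent[THEN conjunct2, THEN conjunct1, rule_format]
    and C2 = consistent[THEN conjunct2, THEN conjunct2, rule_format]
  define I where "I = {..<n} \<times> {..<d}"
  have diag: "cov q (X (i, k)) (X (i, k)) = C i i" if "i < n" "k < d" for i k
  proof -
    have e: "map_pmf (\<lambda>y. y (i, k)) q = map_pmf (\<lambda>x. x i) p"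
      using that by (rule C1_single)
    have "cov q (X (i, k)) (X (i, k)) = cov (map_pmf (\<lambda>y. y (i, k)) q) (f i) (f i)"
      unfolding cov_map_pmf by (simp add: X_def o_def)
    also have "\<dots> = C i i"
      unfolding e cov_map_pmf C_def cov_matrix_eq_cov by (simp add: o_def)
    finally show ?thesis .
  qed
  have shared: "cov q (X (i, k)) (X (j, l)) = C i j"
    if "i < n" "j < n" "k < d" "l < d" "i \<noteq> j" "infl_share m adj prm (i, k) (j, l)" for i j k l
  proof -
    have e: "map_pmf (\<lambda>y. (y (i, k), y (j, l))) q = map_pmf (\<lambda>x. (x i, x j)) p"
      using that by (rule C1_pair)
    have "cov q (X (i, k)) (X (j, l)) = cov (map_pmf (\<lambda>y. (y (i, k), y (j, l))) q) (f i \<circ> fst) (f j \<circ> snd)"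
      unfolding cov_map_pmf by (simp add: X_def o_def)
    also have "\<dots> = C i j"
      unfolding e cov_map_pmf C_def cov_matrix_eq_cov by (simp add: o_def)
    finally show ?thesis .
  qed
  have unshared: "cov q (X (i, k)) (X (j, l)) = 0"
    if "i < n" "j < n" "k < d" "l < d" "(i, k) \<noteq> (j, l)" "\<not> infl_share m adj prm (i, k) (j, l)" for i j k l
  proof -
    have "indep_pair q (\<lambda>y. y (i, k)) (\<lambda>y. y (j, l))"
      using that by (rule C2)
    from cov_indep_pair[OF this, of "f i" "f j"] show ?thesis by (simp add: X_def o_def)
  qed
  \<comment> \<open>Since \<open>prm al i\<close> is injective, different copies of one party never
    share a source copy.\<close>
  have same: "cov q (X (i, k)) (X (i, l)) = (if k = l then C i i else 0)"
    if "i < n" "k < d" "l < d" for i k l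
  proof (cases "k = l")
    case False
    then have "\<not> infl_share m adj prm (i, k) (i, l)"
      using that prm_inj unfolding infl_share_def by auto
    then show ?thesis using that False unshared[of i i k l] by simp
  qed (use that diag in simp)
  \<comment> \<open>NDCS makes this exact: with two common sources the sum could count
    \<open>C i j\<close> twice for one pair of copies, although their covariance is
    \<open>C i j\<close>.\<close>
  have diff: "cov q (X (i, k)) (X (j, l)) = (\<Sum>al\<in>sh i j. if prm al i k = prm al j l then C i j else 0)"
    if "i < n" "j < n" "k < d" "l < d" "i \<noteq> j" for i j k l
  proof (cases "infl_share m adj prm (i, k) (j, l)")
    case True
    then obtain al where al: "al \<in> sh i j" "prm al i k = prm al j l"
      by (auto simp: infl_share_def sh_def)
    have "card (sh i j) \<le> 1"
      using ndcs that unfolding NDCS_def sh_def by blast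
    then have "sh i j = {al}"
      using al(1) fsh[of i j] by (auto dest!: card_le_Suc0_iff_eq[THEN iffD1, rotated])
    then show ?thesis using shared[OF that True] al(2) by simp
  next
    case False
    then have "prm al i k \<noteq> prm al j l" if "al \<in> sh i j" for al
      using that by (auto simp: infl_share_def sh_def)
    then show ?thesis using unshared[of i j k l] that False by simp
  qed
  have diag_block: "(\<Sum>k<d. \<Sum>l<d. cnj (v i k) * cov q (X (i, k)) (X (i, l)) * v i l)
      = C i i * (\<Sum>k<d. of_real ((cmod (v i k))\<^sup>2))" if i: "i \<in> {..<n}" for i
  proof -
    have "(\<Sum>k<d. \<Sum>l<d. cnj (v i k) * cov q (X (i, k)) (X (i, l)) * v i l)
      = (\<Sum>k<d. \<Sum>l<d. if k = l then C i i * of_real ((cmod (v i k))\<^sup>2) else 0)"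
      unfolding complex_norm_square using i by (intro sum.cong refl) (auto simp: same)
    also have "\<dots> = C i i * (\<Sum>k<d. of_real ((cmod (v i k))\<^sup>2))"
      by (simp add: sum_distrib_left)
    finally show ?thesis .
  qed
  have off_diag_block: "(\<Sum>k<d. \<Sum>l<d. cnj (v i k) * cov q (X (i, k)) (X (j, l)) * v j l)
      = (\<Sum>al\<in>sh i j. C i j * (\<Sum>w<d. cnj (v i (s al i w)) * v j (s al j w)))"
    if i: "i \<in> {..<n}" and j: "j \<in> {..<n} - {i}" for i j
  proof -
    have "(\<Sum>k<d. \<Sum>l<d. cnj (v i k) * cov q (X (i, k)) (X (j, l)) * v j l)
      = (\<Sum>k<d. \<Sum>l<d. \<Sum>al\<in>sh i j. if prm al i k = prm al j l then C i j * (cnj (v i k) * v j l) else 0)"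
      using i j by (intro sum.cong refl) (auto simp: diff sum_distrib_left sum_distrib_right intro!: sum.cong)
    also have "\<dots> = (\<Sum>al\<in>sh i j. \<Sum>k<d. \<Sum>l<d. if prm al i k = prm al j l then C i j * (cnj (v i k) * v j l) else 0)"
      by (simp add: sum.swap[of _ "sh i j"])
    also have "\<dots> = (\<Sum>al\<in>sh i j. C i j * (\<Sum>w<d. cnj (v i (s al i w)) * v j (s al j w)))"
    proof (intro sum.cong refl)
      fix al assume "al \<in> sh i j"
      then have al: "al < m" "adj al i" "adj al j" by (auto simp: sh_def)
      have bi: "bij_betw (s al i) {..<d} {..<d}" and bj: "bij_betw (s al j) {..<d} {..<d}"
        using s al i j by auto
      \<comment> \<open>Both copy indices are expressed through source copies; sharing then reads
        \<open>w = z\<close>.\<close>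
      have "(\<Sum>k<d. \<Sum>l<d. if prm al i k = prm al j l then C i j * (cnj (v i k) * v j l) else 0)
        = (\<Sum>w<d. \<Sum>z<d. if prm al i (s al i w) = prm al j (s al j z) then C i j * (cnj (v i (s al i w)) * v j (s al j z)) else 0)"
        by (rule trans[OF sum.reindex_bij_betw[OF bi, symmetric]], rule sum.cong[OF refl])
          (rule sum.reindex_bij_betw[OF bj, symmetric])
      also have "\<dots> = (\<Sum>w<d. \<Sum>z<d. if w = z then C i j * (cnj (v i (s al i w)) * v j (s al j z)) else 0)"
        using al i j by (intro sum.cong refl) (auto simp: prm_s)
      also have "\<dots> = C i j * (\<Sum>w<d. cnj (v i (s al i w)) * v j (s al j w))"
        by (simp add: sum_distrib_left)
      finally show "(\<Sum>k<d. \<Sum>l<d. if prm al i k = prm al j l then C i j * (cnj (v i k) * v j l) else 0) = \<dots>" .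
    qed
    finally show ?thesis .
  qed
  have "0 \<le> Re (\<Sum>a\<in>I. \<Sum>b\<in>I. cnj (v (fst a) (snd a)) * cov q (X a) (X b) * v (fst b) (snd b))"
    (is "0 \<le> Re ?S")
  proof -
    have "finite (range (X a))" for a
      by (rule finite_subset[of _ "range (f (fst a))"]) (auto simp: X_def)
    then show ?thesis
      by (subst cov_quad_form[where v = "\<lambda>a. v (fst a) (snd a)"]) (auto intro: integral_nonneg_AE)
  qed
  also have "?S = (\<Sum>i<n. \<Sum>j<n. \<Sum>k<d. \<Sum>l<d. cnj (v i k) * cov q (X (i, k)) (X (j, l)) * v j l)"
    unfolding I_def by (simp add: sum.cartesian_product' sum.swap[of _ "{..<d}" "{..<n}"])
  also have "\<dots> = (\<Sum>i<n. (\<Sum>k<d. \<Sum>l<d. cnj (v i k) * cov q (X (i, k)) (X (i, l)) * v i l)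
      + (\<Sum>j\<in>{..<n}-{i}. \<Sum>k<d. \<Sum>l<d. cnj (v i k) * cov q (X (i, k)) (X (j, l)) * v j l))"
    by (intro sum.cong refl) (simp add: sum.remove)
  also have "\<dots> = (\<Sum>i<n. C i i * (\<Sum>k<d. of_real ((cmod (v i k))\<^sup>2))
      + (\<Sum>j\<in>{..<n}-{i}. \<Sum>al\<in>sh i j. C i j * (\<Sum>w<d. cnj (v i (s al i w)) * v j (s al j w))))"
    by (rule sum.cong[OF refl], rule arg_cong2[where f = "(+)"], erule diag_block)
      (rule sum.cong[OF refl], erule (1) off_diag_block)
  finally show "0 \<le> Re ((\<Sum>i<n. cov_matrix p f i i * (\<Sum>k<d. of_real ((cmod (v i k))\<^sup>2)))
      + (\<Sum>(al, i, j)\<in>off_diag m n adj. cov_matrix p f i j * (\<Sum>w<d. cnj (v i (s al i w)) * v j (s al j w))))"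
    unfolding sum_off_diag by (simp add: sum.distrib C_def sh_def)
qed

subsection \<open>From permutations to Gram matrices\<close>

lemma extend_bij_betw:
  assumes "finite S" "A \<subseteq> S" "B \<subseteq> S" "bij_betw g A B"
  obtains s where "bij_betw s S S" "\<And>x. x \<in> A \<Longrightarrow> s x = g x"
proof -
  have "card (S - A) = card (S - B)"
    using assms by (metis bij_betw_same_card card_Diff_subset finite_subset)
  then obtain h where h: "bij_betw h (S - A) (S - B)"
    using assms(1) finite_same_card_bij[of "S - A" "S - B"] by auto
  have "bij_betw (\<lambda>x. if x \<in> A then g x else h x) (A \<union> (S - A)) (B \<union> (S - B))"
    using assms(4) h by (rule bij_betw_disjoint_Un) auto
  then show ?thesis
    using assms that[of "\<lambda>x. if x \<in> A then g x else h x"] by (simp add: Un_absorb1)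
qed

lemma sum_Sigma_lessThan_fst:
  fixes g :: "'b \<Rightarrow> complex" and N :: "'b \<Rightarrow> nat"
  assumes "finite A"
  shows "(\<Sum>z\<in>(SIGMA b:A. {..<N b}). g (fst z)) = (\<Sum>b\<in>A. of_nat (N b) * g b)"
  using sum.Sigma[of A "\<lambda>b. {..<N b}" "\<lambda>b _. g b"] assms by (simp add: split_def)

context inflation_form
begin

text \<open>Extend the injections \<^term>\<open>t al i\<close> to permutations so that the coordinates of party \<^term>\<open>i\<close> they
  miss land in an interval of positions private to \<^term>\<open>i\<close>: these then create no cross terms and only
  enlarge the diagonal.\<close>

lemma partial_inj_nat_nonneg:
  fixes D :: "nat \<Rightarrow> nat \<Rightarrow> nat set" and t :: "nat \<Rightarrow> nat \<Rightarrow> nat \<Rightarrow> nat"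
    and v :: "nat \<Rightarrow> nat \<Rightarrow> complex"
  assumes D: "\<And>al i. al < m \<Longrightarrow> i < n \<Longrightarrow> adj al i \<Longrightarrow>
      D al i \<subseteq> {..<e} \<and> inj_on (t al i) (D al i) \<and> t al i ` D al i \<subseteq> {..<e}"
  shows "0 \<le> Re ((\<Sum>i<n. C i i * (\<Sum>k<e. of_real ((cmod (v i k))\<^sup>2)))
      + (\<Sum>(al, i, j)\<in>off_diag m n adj.
          C i j * (\<Sum>w\<in>D al i \<inter> D al j. cnj (v i (t al i w)) * v j (t al j w))))"
proof -
  \<comment> \<open>Room for the \<open>e\<close> given positions and for \<open>n\<close> private
    blocks \<open>Z i\<close> of length \<open>e\<close>; the extra 2 secures the order bound when
    \<open>e = 0\<close>.\<close>
  define d where "d = (n + 1) * e + 2"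
  define Z where "Z i = {e * (i + 1)..<e * (i + 2)}" for i :: nat
  define v' where "v' i k = (if k < e then v i k else 0)" for i k
  have ed: "e \<le> d" by (simp add: d_def)
  have Zd: "Z i \<subseteq> {..<d}" if "i < n" for i
  proof -
    have "e * (i + 2) \<le> e * (n + 1)" using that by (intro mult_left_mono) auto
    then show ?thesis by (auto simp: Z_def d_def mult.commute)
  qed
  have Ze: "e \<le> w" if "w \<in> Z i" for w i
    using that by (auto simp: Z_def)
  have Zdisj: "Z i \<inter> Z j = {}" if "i < j" for i j
  proof -
    have "e * (i + 2) \<le> e * (j + 1)" using that by (intro mult_left_mono) auto
    then show ?thesis by (auto simp: Z_def)
  qed
  have ex: "\<exists>s. bij_betw s {..<d} {..<d} \<and> (\<forall>w\<in>D al i. s w = t al i w)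
      \<and> (\<forall>w<d. w \<notin> D al i \<longrightarrow> s w < e \<longrightarrow> w \<in> Z i)"
    if a: "al < m" "i < n" "adj al i" for al i
  proof -
    define L where "L = {..<e} - t al i ` D al i"
    \<comment> \<open>On \<open>D al i\<close>, \<open>g\<close> agrees with \<open>t al i\<close>;
      on part of the block \<open>Z i\<close> it shifts back onto the values \<open>L\<close> that
      \<open>t al i\<close> misses. Together each value below \<open>e\<close> is hit exactly
      once.\<close>
    define g where "g w = (if w < e then t al i w else w - e * (i + 1))" for w
    have "inj_on (\<lambda>k. e * (i + 1) + k) L" by simp
    then have "bij_betw (\<lambda>w. w - e * (i + 1)) ((\<lambda>k. e * (i + 1) + k) ` L) L"
      by (intro bij_betwI[where g = "\<lambda>k. e * (i + 1) + k"]) auto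
    then have "bij_betw g ((\<lambda>k. e * (i + 1) + k) ` L) L"
      by (rule bij_betw_cong[THEN iffD1, rotated]) (auto simp: g_def)
    moreover have "bij_betw g (D al i) (t al i ` D al i)"
      using D[OF a] by (auto simp: bij_betw_def g_def inj_on_def subset_eq intro!: image_eqI)
    ultimately have "bij_betw g (D al i \<union> (\<lambda>k. e * (i + 1) + k) ` L) (t al i ` D al i \<union> L)"
      by (intro bij_betw_combine) (auto simp: L_def)
    moreover have "t al i ` D al i \<union> L = {..<e}"
      using D[OF a] by (auto simp: L_def)
    ultimately have g: "bij_betw g (D al i \<union> (\<lambda>k. e * (i + 1) + k) ` L) {..<e}" by simp
    have sub: "(\<lambda>k. e * (i + 1) + k) ` L \<subseteq> Z i"
      by (auto simp: Z_def L_def)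
    obtain s where s: "bij_betw s {..<d} {..<d}"
      "\<And>x. x \<in> D al i \<union> (\<lambda>k. e * (i + 1) + k) ` L \<Longrightarrow> s x = g x"
    proof (rule extend_bij_betw[OF _ _ _ g])
      show "D al i \<union> (\<lambda>k. e * (i + 1) + k) ` L \<subseteq> {..<d}"
        using D[OF a] sub Zd[OF a(2)] ed by fastforce
    qed (use ed in auto)
    \<comment> \<open>All values below \<open>e\<close> are already taken by \<open>g\<close>, so
      injectivity of \<open>s\<close> forbids further preimages.\<close>
    have "w \<in> Z i" if w: "w < d" "w \<notin> D al i" "s w < e" for w
    proof -
      have "s w \<in> g ` (D al i \<union> (\<lambda>k. e * (i + 1) + k) ` L)"
        using g w(3) by (auto simp: bij_betw_def)
      then obtain w' where w': "w' \<in> D al i \<union> (\<lambda>k. e * (i + 1) + k) ` L" "s w = s w'"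
        using s(2) by auto
      then have "w' < d" using D[OF a] sub Zd[OF a(2)] ed by fastforce
      with w' w(1) s(1) have "w = w'" by (auto simp: bij_betw_def inj_on_def)
      with w' w(2) sub show ?thesis by auto
    qed
    moreover have "s w = t al i w" if "w \<in> D al i" for w
      using that s(2)[of w] D[OF a] by (auto simp: g_def)
    ultimately show ?thesis using s(1) by blast
  qed
  obtain s where s: "\<And>al i. al < m \<Longrightarrow> i < n \<Longrightarrow> adj al i \<Longrightarrow>
      bij_betw (s al i) {..<d} {..<d} \<and> (\<forall>w\<in>D al i. s al i w = t al i w)
      \<and> (\<forall>w<d. w \<notin> D al i \<longrightarrow> s al i w < e \<longrightarrow> w \<in> Z i)"
    using ex by metis
  have "0 \<le> Re ((\<Sum>i<n. C i i * (\<Sum>k<d. of_real ((cmod (v' i k))\<^sup>2)))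
      + (\<Sum>(al, i, j)\<in>off_diag m n adj. C i j * (\<Sum>w<d. cnj (v' i (s al i w)) * v' j (s al j w))))"
    using s by (intro perm_nonneg) (auto simp: d_def)
  also have "(\<Sum>i<n. C i i * (\<Sum>k<d. of_real ((cmod (v' i k))\<^sup>2)))
      = (\<Sum>i<n. C i i * (\<Sum>k<e. of_real ((cmod (v i k))\<^sup>2)))"
    using ed by (intro sum.cong refl arg_cong2[where f = "(*)"] sum.mono_neutral_cong_right) (auto simp: v'_def)
  also have "(\<Sum>(al, i, j)\<in>off_diag m n adj. C i j * (\<Sum>w<d. cnj (v' i (s al i w)) * v' j (s al j w)))
      = (\<Sum>(al, i, j)\<in>off_diag m n adj.
          C i j * (\<Sum>w\<in>D al i \<inter> D al j. cnj (v i (t al i w)) * v j (t al j w)))"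
  proof (rule sum.cong[OF refl], clarify, rule arg_cong2[where f = "(*)", OF refl], rule sum.mono_neutral_cong_right)
    fix al i j assume "(al, i, j) \<in> off_diag m n adj"
    then have a: "al < m" "i < n" "adj al i" "j < n" "adj al j" "i \<noteq> j" by (auto simp: off_diag_def)
    note Di = D[OF a(1-3)] and Dj = D[OF a(1,4,5)] and si = s[OF a(1-3)] and sj = s[OF a(1,4,5)]
    show "D al i \<inter> D al j \<subseteq> {..<d}" using Di ed by auto
    have Zij: "Z i \<inter> Z j = {}" using a(6) Zdisj[of i j] Zdisj[of j i] by (cases "i < j") auto
    \<comment> \<open>A nonzero term needs both images below \<open>e\<close>, hence
      \<open>w\<close> in \<open>D al i\<close> or \<open>Z i\<close>, and in \<open>D al j\<close>
      or \<open>Z j\<close>. The sets \<open>D\<close> lie below \<open>e\<close>, the blocks at or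
      above \<open>e\<close> and apart from each other, so \<open>w\<close> would lie in both
      \<open>D al i\<close> and \<open>D al j\<close>.\<close>
    show "\<forall>w\<in>{..<d} - D al i \<inter> D al j. cnj (v' i (s al i w)) * v' j (s al j w) = 0"
    proof (rule ballI, rule ccontr)
      fix w assume w: "w \<in> {..<d} - D al i \<inter> D al j" "cnj (v' i (s al i w)) * v' j (s al j w) \<noteq> 0"
      then have lt: "s al i w < e" "s al j w < e" by (auto simp: v'_def split: if_splits)
      have 1: "w \<in> D al i \<or> w \<in> Z i" and 2: "w \<in> D al j \<or> w \<in> Z j" and 3: "w \<notin> D al i \<inter> D al j"
        using si sj w lt by auto
      have "D al i \<inter> Z j = {}" "D al j \<inter> Z i = {}" using Di Dj Ze by fastforce+
      with 1 2 3 Zij show False by blast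
    qed
    show "cnj (v' i (s al i w)) * v' j (s al j w) = cnj (v i (t al i w)) * v j (t al j w)"
      if "w \<in> D al i \<inter> D al j" for w
      using that si sj Di Dj by (auto simp: v'_def)
  qed simp
  finally show ?thesis .
qed

text \<open>Only the identity of the copies matters: \<open>V i\<close> labels copies of party
  \<open>i\<close> and \<open>W al\<close> copies of source \<open>al\<close>. Numbering them
  injectively below a common bound reduces the claim to natural numbers.\<close>

lemma partial_inj_nonneg:
  fixes D :: "nat \<Rightarrow> nat \<Rightarrow> 'w set" and t :: "nat \<Rightarrow> nat \<Rightarrow> 'w \<Rightarrow> 's" and V :: "nat \<Rightarrow> 's set"
    and v :: "nat \<Rightarrow> 's \<Rightarrow> complex"
  assumes V: "\<And>i. i < n \<Longrightarrow> finite (V i)" and W: "\<And>al. al < m \<Longrightarrow> finite (W al)"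
    and D: "\<And>al i. al < m \<Longrightarrow> i < n \<Longrightarrow> adj al i \<Longrightarrow>
      D al i \<subseteq> W al \<and> inj_on (t al i) (D al i) \<and> t al i ` D al i \<subseteq> V i"
  shows "0 \<le> Re ((\<Sum>i<n. C i i * (\<Sum>k\<in>V i. of_real ((cmod (v i k))\<^sup>2)))
      + (\<Sum>(al, i, j)\<in>off_diag m n adj.
          C i j * (\<Sum>w\<in>D al i \<inter> D al j. cnj (v i (t al i w)) * v j (t al j w))))"
proof -
  define e where "e = (\<Sum>i<n. card (V i)) + (\<Sum>al<m. card (W al))"
  have eV: "card (V i) \<le> e" if "i < n" for i
    using that member_le_sum[of i "{..<n}" "\<lambda>i. card (V i)"] by (simp add: e_def)
  have eW: "card (W al) \<le> e" if "al < m" for al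
    using that member_le_sum[of al "{..<m}" "\<lambda>i. card (W i)"] by (simp add: e_def)
  have "\<forall>i<n. \<exists>h. inj_on h (V i) \<and> h ` V i \<subseteq> {..<e}"
    using eV V by (metis card_le_inj finite_lessThan card_lessThan)
  then obtain hV where hV: "\<And>i. i < n \<Longrightarrow> inj_on (hV i) (V i) \<and> hV i ` V i \<subseteq> {..<e}" by metis
  have "\<forall>al<m. \<exists>h. inj_on h (W al) \<and> h ` W al \<subseteq> {..<e}"
    using eW W by (metis card_le_inj finite_lessThan card_lessThan)
  then obtain hW where hW: "\<And>al. al < m \<Longrightarrow> inj_on (hW al) (W al) \<and> hW al ` W al \<subseteq> {..<e}" by metis
  define D' where "D' al i = hW al ` D al i" for al i
  define t' where "t' al i = hV i \<circ> t al i \<circ> inv_into (W al) (hW al)" for al i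
  define v' where "v' i k = (if k \<in> hV i ` V i then v i (inv_into (V i) (hV i) k) else 0)" for i k
  have inv: "inv_into (W al) (hW al) (hW al w) = w" if "al < m" "w \<in> W al" for al w
    using that hW by simp
  have v'hV: "v' i (hV i k) = v i k" if "i < n" "k \<in> V i" for i k
    using that hV[of i] by (auto simp: v'_def)
  have "0 \<le> Re ((\<Sum>i<n. C i i * (\<Sum>k<e. of_real ((cmod (v' i k))\<^sup>2)))
      + (\<Sum>(al, i, j)\<in>off_diag m n adj.
          C i j * (\<Sum>w\<in>D' al i \<inter> D' al j. cnj (v' i (t' al i w)) * v' j (t' al j w))))"
  proof (rule partial_inj_nat_nonneg)
    fix al i assume a: "al < m" "i < n" "adj al i"
    note Da = D[OF a] and hWa = hW[OF a(1)] and hVa = hV[OF a(2)]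
    have [simp]: "inv_into (W al) (hW al) (hW al w) = w" if "w \<in> D al i" for w
      using that Da inv a by blast
    have "inj_on (t' al i) (D' al i)"
    proof (rule inj_onI)
      fix x y assume "x \<in> D' al i" "y \<in> D' al i" "t' al i x = t' al i y"
      then obtain w z where wz: "x = hW al w" "y = hW al z" "w \<in> D al i" "z \<in> D al i"
        "hV i (t al i w) = hV i (t al i z)" by (auto simp: D'_def t'_def)
      then have "t al i w = t al i z" using hVa Da by (auto simp: inj_on_def image_subset_iff)
      with wz Da show "x = y" by (auto simp: inj_on_def)
    qed
    moreover have "D' al i \<subseteq> {..<e}" using Da hWa by (auto simp: D'_def)
    moreover have "t' al i ` D' al i \<subseteq> {..<e}"
      using Da hVa by (auto simp: D'_def t'_def image_subset_iff)
    ultimately show "D' al i \<subseteq> {..<e} \<and> inj_on (t' al i) (D' al i) \<and> t' al i ` D' al i \<subseteq> {..<e}" by blast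
  qed
  also have "(\<Sum>i<n. C i i * (\<Sum>k<e. of_real ((cmod (v' i k))\<^sup>2)))
      = (\<Sum>i<n. C i i * (\<Sum>k\<in>V i. of_real ((cmod (v i k))\<^sup>2)))"
  proof (intro sum.cong refl arg_cong2[where f = "(*)"])
    fix i assume i: "i \<in> {..<n}"
    have "(\<Sum>k<e. complex_of_real ((cmod (v' i k))\<^sup>2)) = (\<Sum>k\<in>hV i ` V i. of_real ((cmod (v' i k))\<^sup>2))"
      using hV[of i] i by (intro sum.mono_neutral_right) (auto simp: v'_def)
    also have "\<dots> = (\<Sum>k\<in>V i. of_real ((cmod (v i k))\<^sup>2))"
      using hV[of i] i by (simp add: sum.reindex v'hV)
    finally show "(\<Sum>k<e. complex_of_real ((cmod (v' i k))\<^sup>2)) = \<dots>" .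
  qed
  also have "(\<Sum>(al, i, j)\<in>off_diag m n adj.
          C i j * (\<Sum>w\<in>D' al i \<inter> D' al j. cnj (v' i (t' al i w)) * v' j (t' al j w)))
      = (\<Sum>(al, i, j)\<in>off_diag m n adj.
          C i j * (\<Sum>w\<in>D al i \<inter> D al j. cnj (v i (t al i w)) * v j (t al j w)))"
  proof (rule sum.cong[OF refl], clarify, rule arg_cong2[where f = "(*)", OF refl])
    fix al i j assume "(al, i, j) \<in> off_diag m n adj"
    then have a: "al < m" "i < n" "adj al i" "j < n" "adj al j" by (auto simp: off_diag_def)
    note Di = D[OF a(1-3)] and Dj = D[OF a(1,4,5)]
    have inj: "inj_on (hW al) (D al i \<inter> D al j)"
      using hW[OF a(1)] Di by (meson inf.coboundedI1 inj_on_subset)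
    have eq: "D' al i \<inter> D' al j = hW al ` (D al i \<inter> D al j)"
      unfolding D'_def using hW[OF a(1)] Di Dj by (intro inj_on_image_Int[symmetric]) auto
    have "w \<in> W al \<and> t al i w \<in> V i \<and> t al j w \<in> V j" if "w \<in> D al i \<inter> D al j" for w
      using that Di Dj by auto
    then show "(\<Sum>w\<in>D' al i \<inter> D' al j. cnj (v' i (t' al i w)) * v' j (t' al j w))
      = (\<Sum>w\<in>D al i \<inter> D al j. cnj (v i (t al i w)) * v j (t al j w))"
      unfolding eq sum.reindex[OF inj] o_def
      by (intro sum.cong refl) (simp add: t'_def inv v'hV a)
  qed
  finally show ?thesis .
qed

text \<open>Multiplicities are realised by copies: label \<open>b\<close> of party \<open>i\<close>
  becomes \<open>N i b\<close> coordinates with the same entry \<open>x i b\<close>, and label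
  \<open>w\<close> of source \<open>al\<close> becomes \<open>c al w\<close> source copies. The
  bound \<open>cap\<close> says that the source copies fit injectively into the coordinates.\<close>

lemma nat_weight_nonneg:
  fixes D :: "nat \<Rightarrow> nat \<Rightarrow> 'w set" and lab :: "nat \<Rightarrow> nat \<Rightarrow> 'w \<Rightarrow> 'b"
    and x :: "nat \<Rightarrow> 'b \<Rightarrow> complex" and c :: "nat \<Rightarrow> 'w \<Rightarrow> nat" and N :: "nat \<Rightarrow> 'b \<Rightarrow> nat"
  assumes B: "finite B" and W: "\<And>al. al < m \<Longrightarrow> finite (W al)"
    and D: "\<And>al i. al < m \<Longrightarrow> i < n \<Longrightarrow> adj al i \<Longrightarrow> D al i \<subseteq> W al \<and> lab al i ` D al i \<subseteq> B"
    and cap: "\<And>al i b. al < m \<Longrightarrow> i < n \<Longrightarrow> adj al i \<Longrightarrow> b \<in> B \<Longrightarrow>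
      (\<Sum>w\<in>{w \<in> D al i. lab al i w = b}. c al w) \<le> N i b"
  shows "0 \<le> Re ((\<Sum>i<n. C i i * (\<Sum>b\<in>B. of_nat (N i b) * of_real ((cmod (x i b))\<^sup>2)))
      + (\<Sum>(al, i, j)\<in>off_diag m n adj.
          C i j * (\<Sum>w\<in>D al i \<inter> D al j. of_nat (c al w) * (cnj (x i (lab al i w)) * x j (lab al j w)))))"
proof -
  define V where "V i = (SIGMA b:B. {..<N i b})" for i
  define cp where "cp al A = (SIGMA w:A. {..<c al w})" for al A
  define P where "P al i t \<longleftrightarrow> inj_on t (cp al (D al i)) \<and> t ` cp al (D al i) \<subseteq> V i
    \<and> (\<forall>z\<in>cp al (D al i). fst (t z) = lab al i (fst z))" for al i t
  define t where "t al i = (SOME t. P al i t)" for al i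
  have ex: "\<exists>t. P al i t"
    if a: "al < m" "i < n" "adj al i" for al i
  proof -
    note Da = D[OF a]
    have fD: "finite (D al i)" using Da W[OF a(1)] finite_subset by blast
    define E where "E b = cp al {w \<in> D al i. lab al i w = b}" for b
    \<comment> \<open>Each fibre of the labelling gets its own \<open>N i b\<close> slots; distinct
      fibres are then separated by the label in the first component.\<close>
    have "\<forall>b\<in>B. \<exists>h. h ` E b \<subseteq> {..<N i b} \<and> inj_on h (E b)"
    proof (intro ballI card_le_inj)
      fix b assume b: "b \<in> B"
      show "card (E b) \<le> card {..<N i b}"
        using cap[OF a b] fD by (simp add: E_def cp_def)
    qed (use fD in \<open>auto simp: E_def cp_def\<close>)
    from bchoice[OF this] obtain h
      where h: "\<forall>b\<in>B. h b ` E b \<subseteq> {..<N i b} \<and> inj_on (h b) (E b)" ..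
    define t where "t z = (lab al i (fst z), h (lab al i (fst z)) z)" for z
    have mem: "lab al i (fst z) \<in> B \<and> z \<in> E (lab al i (fst z))"
      if "z \<in> cp al (D al i)" for z
      using that Da by (auto simp: cp_def E_def)
    have "inj_on t (cp al (D al i))"
    proof (rule inj_onI)
      fix y z assume y: "y \<in> cp al (D al i)" and z: "z \<in> cp al (D al i)" and "t y = t z"
      then have l: "lab al i (fst y) = lab al i (fst z)" "h (lab al i (fst z)) y = h (lab al i (fst z)) z"
        by (auto simp: t_def)
      with mem[OF y] mem[OF z] h show "y = z"
        by (metis inj_onD)
    qed
    moreover have "t ` cp al (D al i) \<subseteq> V i"
      using mem h unfolding t_def V_def by blast
    ultimately show ?thesis unfolding P_def by (intro exI[of _ t]) (simp add: t_def)
  qed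
  have t: "P al i (t al i)" if "al < m" "i < n" "adj al i" for al i
    unfolding t_def by (rule someI_ex[OF ex[OF that]])
  have "0 \<le> Re ((\<Sum>i<n. C i i * (\<Sum>k\<in>V i. of_real ((cmod (x i (fst k)))\<^sup>2)))
      + (\<Sum>(al, i, j)\<in>off_diag m n adj.
          C i j * (\<Sum>z\<in>cp al (D al i) \<inter> cp al (D al j). cnj (x i (fst (t al i z))) * x j (fst (t al j z)))))"
  proof (rule partial_inj_nonneg[where W = "\<lambda>al. cp al (W al)"])
    fix al i assume a: "al < m" "i < n" "adj al i"
    show "cp al (D al i) \<subseteq> cp al (W al) \<and> inj_on (t al i) (cp al (D al i)) \<and> t al i ` cp al (D al i) \<subseteq> V i"
      using t[OF a] D[OF a] unfolding P_def by (auto simp: cp_def)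
  qed (use B W in \<open>auto simp: V_def cp_def\<close>)
  also have "(\<Sum>i<n. C i i * (\<Sum>k\<in>V i. of_real ((cmod (x i (fst k)))\<^sup>2)))
      = (\<Sum>i<n. C i i * (\<Sum>b\<in>B. of_nat (N i b) * of_real ((cmod (x i b))\<^sup>2)))"
    unfolding V_def by (rule sum.cong[OF refl], rule arg_cong2[where f = "(*)", OF refl]) (rule sum_Sigma_lessThan_fst[OF B])
  also have "(\<Sum>(al, i, j)\<in>off_diag m n adj.
          C i j * (\<Sum>z\<in>cp al (D al i) \<inter> cp al (D al j). cnj (x i (fst (t al i z))) * x j (fst (t al j z))))
     = (\<Sum>(al, i, j)\<in>off_diag m n adj.
          C i j * (\<Sum>w\<in>D al i \<inter> D al j. of_nat (c al w) * (cnj (x i (lab al i w)) * x j (lab al j w))))"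
  proof (rule sum.cong[OF refl], clarify, rule arg_cong2[where f = "(*)", OF refl])
    fix al i j assume "(al, i, j) \<in> off_diag m n adj"
    then have a: "al < m" "i < n" "adj al i" "j < n" "adj al j" by (auto simp: off_diag_def)
    have fD: "finite (D al i \<inter> D al j)" using D[OF a(1-3)] W[OF a(1)] finite_subset by blast
    \<comment> \<open>The number of copies of \<open>w\<close> depends on the source but not on the
      party, so copying commutes with intersection.\<close>
    have "cp al (D al i) \<inter> cp al (D al j) = cp al (D al i \<inter> D al j)" by (auto simp: cp_def)
    moreover have "(\<Sum>z\<in>cp al (D al i) \<inter> cp al (D al j). cnj (x i (fst (t al i z))) * x j (fst (t al j z)))
      = (\<Sum>z\<in>cp al (D al i) \<inter> cp al (D al j). cnj (x i (lab al i (fst z))) * x j (lab al j (fst z)))"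
      using t[OF a(1-3)] t[OF a(1,4,5)] unfolding P_def by (intro sum.cong refl) simp
    ultimately show "(\<Sum>z\<in>cp al (D al i) \<inter> cp al (D al j). cnj (x i (fst (t al i z))) * x j (fst (t al j z)))
      = (\<Sum>w\<in>D al i \<inter> D al j. of_nat (c al w) * (cnj (x i (lab al i w)) * x j (lab al j w)))"
      using sum_Sigma_lessThan_fst[OF fD] by (simp add: cp_def)
  qed
  finally show ?thesis .
qed

end

section \<open>Real weights and embezzling vectors\<close>

lemma floor_multiple_tendsto:
  fixes a :: real
  assumes "a \<ge> 0"
  shows "(\<lambda>K. of_nat (nat \<lfloor>real K * a\<rfloor>) / real K) \<longlonglongrightarrow> a"
proof (rule tendsto_sandwich)
  show "(\<lambda>K. a - 1 / real K) \<longlonglongrightarrow> a"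
    using tendsto_diff[OF tendsto_const lim_1_over_n, of a] by simp
  show "\<forall>\<^sub>F K in sequentially. a - 1 / real K \<le> of_nat (nat \<lfloor>real K * a\<rfloor>) / real K"
    using eventually_gt_at_top[of 0]
  proof eventually_elim
    case (elim K)
    have "real K * a - 1 \<le> of_nat (nat \<lfloor>real K * a\<rfloor>)" by linarith
    from divide_right_mono[OF this, of "real K"] elim show ?case by (simp add: diff_divide_distrib)
  qed
  show "\<forall>\<^sub>F K in sequentially. of_nat (nat \<lfloor>real K * a\<rfloor>) / real K \<le> a"
    using eventually_gt_at_top[of 0]
  proof eventually_elim
    case (elim K)
    have "of_nat (nat \<lfloor>real K * a\<rfloor>) \<le> real K * a" using assms by (simp add: of_nat_floor)
    from divide_right_mono[OF this, of "real K"] elim show ?case by simp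
  qed
qed simp

text \<open>The expression is linear in the weights, so the integer case applied to
  \<open>\<lfloor>K * a\<rfloor>\<close> may be divided by \<open>K\<close>, and the inequality
  survives the limit of large \<open>K\<close>.\<close>

lemma (in inflation_form) weight_nonneg:
  fixes D :: "nat \<Rightarrow> nat \<Rightarrow> 'w set" and lab :: "nat \<Rightarrow> nat \<Rightarrow> 'w \<Rightarrow> 'b"
    and x :: "nat \<Rightarrow> 'b \<Rightarrow> complex" and c :: "nat \<Rightarrow> 'w \<Rightarrow> real" and N :: "nat \<Rightarrow> 'b \<Rightarrow> real"
  assumes B: "finite B" and W: "\<And>al. al < m \<Longrightarrow> finite (W al)"
    and D: "\<And>al i. al < m \<Longrightarrow> i < n \<Longrightarrow> adj al i \<Longrightarrow> D al i \<subseteq> W al \<and> lab al i ` D al i \<subseteq> B"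
    and cap: "\<And>al i b. al < m \<Longrightarrow> i < n \<Longrightarrow> adj al i \<Longrightarrow> b \<in> B \<Longrightarrow>
      (\<Sum>w\<in>{w \<in> D al i. lab al i w = b}. c al w) \<le> N i b"
    and c: "\<And>al w. c al w \<ge> 0" and N: "\<And>i b. N i b \<ge> 0"
  shows "0 \<le> Re ((\<Sum>i<n. C i i * (\<Sum>b\<in>B. of_real (N i b) * of_real ((cmod (x i b))\<^sup>2)))
      + (\<Sum>(al, i, j)\<in>off_diag m n adj.
          C i j * (\<Sum>w\<in>D al i \<inter> D al j. of_real (c al w) * (cnj (x i (lab al i w)) * x j (lab al j w)))))"
    (is "0 \<le> Re ?F")
proof -
  define r where "r K a = real (nat \<lfloor>real K * a\<rfloor>)" for K a
  define F where "F K = (\<Sum>i<n. C i i * (\<Sum>b\<in>B. of_real (r K (N i b) / K) * of_real ((cmod (x i b))\<^sup>2)))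
      + (\<Sum>(al, i, j)\<in>off_diag m n adj.
          C i j * (\<Sum>w\<in>D al i \<inter> D al j. of_real (r K (c al w) / K) * (cnj (x i (lab al i w)) * x j (lab al j w))))"
    for K :: nat
  have "F \<longlonglongrightarrow> ?F"
    unfolding F_def r_def split_def
    by (intro tendsto_intros floor_multiple_tendsto c N)
  then have "(\<lambda>K. Re (F K)) \<longlonglongrightarrow> Re ?F" by (rule tendsto_Re)
  moreover have "0 \<le> Re (F K)" if K: "K > 0" for K
  proof -
    have "0 \<le> Re ((\<Sum>i<n. C i i * (\<Sum>b\<in>B. of_nat (nat \<lfloor>real K * N i b\<rfloor>) * of_real ((cmod (x i b))\<^sup>2)))
      + (\<Sum>(al, i, j)\<in>off_diag m n adj.
          C i j * (\<Sum>w\<in>D al i \<inter> D al j. of_nat (nat \<lfloor>real K * c al w\<rfloor>) * (cnj (x i (lab al i w)) * x j (lab al j w)))))"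
      (is "0 \<le> Re ?G")
    proof (rule nat_weight_nonneg[OF B W D])
      fix al i b assume a: "al < m" "i < n" "adj al i" "b \<in> B"
      let ?E = "{w \<in> D al i. lab al i w = b}"
      \<comment> \<open>Rounding down preserves the capacity bound: a sum of floors is an integer of
        size at most \<open>K * N i b\<close>, hence at most its floor.\<close>
      have "real (\<Sum>w\<in>?E. nat \<lfloor>real K * c al w\<rfloor>) \<le> (\<Sum>w\<in>?E. real K * c al w)"
        using c by (simp add: of_nat_nat) (intro sum_mono, linarith)
      also have "\<dots> \<le> real K * N i b"
        using cap[OF a] by (simp add: sum_distrib_left[symmetric] mult_left_mono)
      finally show "(\<Sum>w\<in>?E. nat \<lfloor>real K * c al w\<rfloor>) \<le> nat \<lfloor>real K * N i b\<rfloor>"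
        by (simp add: le_nat_floor)
    qed auto
    moreover have "F K = ?G / of_nat K"
      by (simp add: F_def r_def split_def add_divide_distrib sum_divide_distrib sum_distrib_left)
    ultimately show ?thesis by (simp add: Re_divide_of_nat)
  qed
  then have "\<forall>\<^sub>F K in sequentially. 0 \<le> Re (F K)"
    using eventually_gt_at_top[of 0] by (rule eventually_mono[rotated])
  ultimately show ?thesis
    by (intro tendsto_lowerbound) auto
qed

text \<open>Embezzlement. The vector with entries \<open>val s\<close>, each weighted by \<open>1 / \<bar>val s\<bar>\<^sup>2\<close>, is up to
  relative boundary effects of order \<open>1 / K\<close> mapped to a relabelling of itself under tensoring with any
  unit vector whose coordinates are among the \<open>z g\<close>: multiplication by \<open>z g\<close> shifts the exponent
  \<open>s g\<close> by one. So one vector per party serves all sources of that party simultaneously.\<close>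

lemma (in inflation_form) gram_nonneg:
  fixes u :: "nat \<Rightarrow> nat \<Rightarrow> nat \<Rightarrow> complex" and y :: "nat \<Rightarrow> real"
  assumes y: "\<And>i. y i \<ge> 0"
    and uy: "\<And>al i. al < m \<Longrightarrow> i < n \<Longrightarrow> adj al i \<Longrightarrow> (\<Sum>l<r. (cmod (u al i l))\<^sup>2) \<le> y i"
  shows "0 \<le> Re ((\<Sum>i<n. C i i * of_real (y i))
      + (\<Sum>(al, i, j)\<in>off_diag m n adj. C i j * (\<Sum>l<r. cnj (u al i l) * u al j l)))"
proof -
  define G where "G = {..<m} \<times> {..<n} \<times> {..<r}"
  \<comment> \<open>Zero coordinates are replaced by 1 to keep \<open>val\<close> nonzero;
    \<open>D\<close> below excludes the corresponding indices.\<close>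
  define z where "z = (\<lambda>(al, i, l). if u al i l = 0 then 1 else u al i l)"
  define val where "val s = (\<Prod>g\<in>G. z g ^ s g)" for s :: "nat \<times> nat \<times> nat \<Rightarrow> nat"
  define box where "box K = (PiE G (\<lambda>_. {..<K}))" for K :: nat
  define D where "D K al i = {w \<in> {..<r} \<times> box K. u al i (fst w) \<noteq> 0}" for K al i
  \<comment> \<open>\<open>w\<close> is an index of the tensor product of \<open>u al i\<close> with
    the embezzling vector; raising one exponent by one records the factor
    \<open>u al i (fst w)\<close>.\<close>
  define lab where "lab al i w = (snd w)((al, i, fst w) := Suc (snd w (al, i, fst w)))"
    for al i and w :: "nat \<times> (nat \<times> nat \<times> nat \<Rightarrow> nat)"
  define wt where "wt w = 1 / (cmod (val (snd w)))\<^sup>2" for w :: "nat \<times> (nat \<times> nat \<times> nat \<Rightarrow> nat)"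
  have finG: "finite G" by (simp add: G_def)
  have fin_box: "finite (box K)" for K unfolding box_def using finG by (intro finite_PiE) auto
  have card_box: "card (box K) = K ^ card G" for K
    unfolding box_def using finG by (simp add: card_PiE)
  have val_nz: "val s \<noteq> 0" for s
    using finG by (auto simp: val_def z_def split: if_splits)
  have val_lab: "val (lab al i w) = u al i (fst w) * val (snd w)"
    if "al < m" "i < n" "w \<in> D K al i" for al i w K
  proof -
    let ?g = "(al, i, fst w)"
    have g: "?g \<in> G" using that by (auto simp: G_def D_def)
    have "val (lab al i w) = z ?g ^ Suc (snd w ?g) * (\<Prod>g\<in>G - {?g}. z g ^ snd w g)"
      unfolding val_def prod.remove[OF finG g] lab_def by (intro arg_cong2[where f = "(*)"] prod.cong) auto
    also have "\<dots> = z ?g * val (snd w)"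
      unfolding val_def prod.remove[OF finG g] by simp
    finally show ?thesis using that(3) by (simp add: z_def D_def)
  qed
  have lab_box: "lab al i w \<in> box (Suc K)" if "al < m" "i < n" "w \<in> D K al i" for al i w K
  proof -
    have s: "snd w \<in> box K" and g: "(al, i, fst w) \<in> G" using that by (auto simp: D_def G_def)
    have "snd w h < K" if "h \<in> G" for h using s that by (auto simp: box_def)
    moreover have "snd w h = undefined" if "h \<notin> G" for h using s that by (auto simp: box_def)
    ultimately show ?thesis
      using g by (auto simp: lab_def box_def PiE_iff extensional_def intro: less_SucI)
  qed
  define A where "A = (\<Sum>i<n. C i i * of_real (y i))"
  define S where "S = (\<Sum>(al, i, j)\<in>off_diag m n adj. C i j * (\<Sum>l<r. cnj (u al i l) * u al j l))"
  \<comment> \<open>The two factors are box sizes: tensoring runs over exponents in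
    \<open>box K\<close>, but since \<open>lab\<close> raises an exponent, the labels of a party
    need \<open>box (Suc K)\<close>. The ratio of the sizes tends to 1.\<close>
  have main: "0 \<le> Re (of_nat (Suc K ^ card G) * A + of_nat (K ^ card G) * S)" for K
  proof -
    have "0 \<le> Re ((\<Sum>i<n. C i i * (\<Sum>b\<in>box (Suc K). of_real (y i / (cmod (val b))\<^sup>2) * of_real ((cmod (val b))\<^sup>2)))
      + (\<Sum>(al, i, j)\<in>off_diag m n adj.
          C i j * (\<Sum>w\<in>D K al i \<inter> D K al j. of_real (wt w) * (cnj (val (lab al i w)) * val (lab al j w)))))"
    proof (rule weight_nonneg[where W = "\<lambda>_. {..<r} \<times> box K"])
      fix al i b assume a: "al < m" "i < n" "adj al i" and b: "b \<in> box (Suc K)"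
      let ?E = "{w \<in> D K al i. lab al i w = b}"
      have "wt w = (cmod (u al i (fst w)))\<^sup>2 / (cmod (val b))\<^sup>2" if "w \<in> ?E" for w
        using that val_lab[OF a(1,2), of w K] val_nz[of "snd w"]
        by (auto simp: wt_def norm_mult power_mult_distrib D_def)
      then have "(\<Sum>w\<in>?E. wt w) = (\<Sum>w\<in>?E. (cmod (u al i (fst w)))\<^sup>2) / (cmod (val b))\<^sup>2"
        by (simp add: sum_divide_distrib)
      also have "(\<Sum>w\<in>?E. (cmod (u al i (fst w)))\<^sup>2) = (\<Sum>l\<in>fst ` ?E. (cmod (u al i l))\<^sup>2)"
      proof (subst sum.reindex)
        \<comment> \<open>The label and the coordinate together determine the exponents, so a fibre
          contains each coordinate \<open>l\<close> at most once and its total is bounded by the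
          squared norm of \<open>u al i\<close>.\<close>
        show "inj_on fst ?E"
        proof (rule inj_onI)
          fix v w assume vw: "v \<in> ?E" "w \<in> ?E" "fst v = fst w"
          then have *: "lab al i v = lab al i w" by simp
          have "snd v g = snd w g" for g
            using fun_cong[OF *, of g] vw(3) by (auto simp: lab_def split: if_splits)
          then have "snd v = snd w" by (rule ext)
          with vw(3) show "v = w" by (rule prod_eqI)
        qed
      qed simp
      also have "\<dots> \<le> (\<Sum>l<r. (cmod (u al i l))\<^sup>2)"
        by (intro sum_mono2) (auto simp: D_def)
      also have "\<dots> \<le> y i" using uy[OF a] .
      finally show "(\<Sum>w\<in>?E. wt w) \<le> y i / (cmod (val b))\<^sup>2"
        by (simp add: divide_right_mono)
    next
      fix al i assume "al < m" "i < n" "adj al i"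
      then show "D K al i \<subseteq> {..<r} \<times> box K \<and> lab al i ` D K al i \<subseteq> box (Suc K)"
        using lab_box by (auto simp: D_def)
    qed (use fin_box y in \<open>auto simp: wt_def\<close>)
    also have "(\<Sum>i<n. C i i * (\<Sum>b\<in>box (Suc K). of_real (y i / (cmod (val b))\<^sup>2) * of_real ((cmod (val b))\<^sup>2)))
        = of_nat (Suc K ^ card G) * A"
    proof -
      have "(\<Sum>b\<in>box (Suc K). of_real (y i / (cmod (val b))\<^sup>2) * of_real ((cmod (val b))\<^sup>2))
        = (of_nat (Suc K ^ card G) * of_real (y i) :: complex)" for i
      proof -
        have "(\<Sum>b\<in>box (Suc K). of_real (y i / (cmod (val b))\<^sup>2) * of_real ((cmod (val b))\<^sup>2))
          = (\<Sum>b\<in>box (Suc K). of_real (y i) :: complex)"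
          using val_nz by (intro sum.cong refl) (simp flip: of_real_mult)
        then show ?thesis by (simp add: card_box del: of_nat_Suc of_nat_power)
      qed
      then show ?thesis by (simp add: A_def sum_distrib_left mult_ac del: of_nat_Suc of_nat_power power_Suc)
    qed
    also have "(\<Sum>(al, i, j)\<in>off_diag m n adj.
          C i j * (\<Sum>w\<in>D K al i \<inter> D K al j. of_real (wt w) * (cnj (val (lab al i w)) * val (lab al j w))))
        = of_nat (K ^ card G) * S"
    proof -
      \<comment> \<open>The weight \<open>wt\<close> cancels the squared modulus of
        \<open>val (snd w)\<close>, so every exponent vector in the box contributes the same Gram
        entry.\<close>
      have block: "(\<Sum>w\<in>D K al i \<inter> D K al j. of_real (wt w) * (cnj (val (lab al i w)) * val (lab al j w)))
        = of_nat (K ^ card G) * (\<Sum>l<r. cnj (u al i l) * u al j l)"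
        if a: "al < m" "i < n" "j < n" for al i j
      proof -
        have "(\<Sum>w\<in>D K al i \<inter> D K al j. of_real (wt w) * (cnj (val (lab al i w)) * val (lab al j w)))
          = (\<Sum>w\<in>D K al i \<inter> D K al j. cnj (u al i (fst w)) * u al j (fst w))"
        proof (intro sum.cong refl)
          fix w assume w: "w \<in> D K al i \<inter> D K al j"
          have "of_real (wt w) * (cnj (val (snd w)) * val (snd w)) = 1"
            using val_nz[of "snd w"] complex_norm_square[of "val (snd w)"]
            by (simp add: wt_def mult.commute)
          then have "cnj (u al i (fst w)) * u al j (fst w)
            = cnj (u al i (fst w)) * u al j (fst w) * (of_real (wt w) * (cnj (val (snd w)) * val (snd w)))"
            by simp
          then show "of_real (wt w) * (cnj (val (lab al i w)) * val (lab al j w)) = cnj (u al i (fst w)) * u al j (fst w)"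
            using w a by (simp add: val_lab[of al _ w K] mult_ac)
        qed
        also have "\<dots> = (\<Sum>w\<in>{..<r} \<times> box K. cnj (u al i (fst w)) * u al j (fst w))"
          using fin_box by (intro sum.mono_neutral_left) (auto simp: D_def)
        also have "\<dots> = (\<Sum>l<r. \<Sum>s\<in>box K. cnj (u al i l) * u al j l)"
          by (simp add: sum.cartesian_product')
        also have "\<dots> = of_nat (K ^ card G) * (\<Sum>l<r. cnj (u al i l) * u al j l)"
          by (simp add: card_box sum_distrib_left)
        finally show ?thesis .
      qed
      show ?thesis
        unfolding S_def
        by (subst sum_distrib_left[of "of_nat (K ^ card G)"], rule sum.cong[OF refl])
          (auto simp: off_diag_def block simp del: of_nat_power)
    qed
    finally show ?thesis .
  qed
  have "(\<lambda>K. Re (of_real ((real (Suc K) / real K) ^ card G) * A + S)) \<longlonglongrightarrow> Re (of_real (1 ^ card G) * A + S)"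
    by (intro tendsto_intros LIMSEQ_Suc_n_over_n)
  moreover have "\<forall>\<^sub>F K in sequentially. 0 \<le> Re (of_real ((real (Suc K) / real K) ^ card G) * A + S)"
    using eventually_gt_at_top[of 0]
  proof eventually_elim
    case (elim K)
    have "of_real ((real (Suc K) / real K) ^ card G) * A + S
      = (of_nat (Suc K ^ card G) * A + of_nat (K ^ card G) * S) / of_nat (K ^ card G)"
      using elim by (simp add: power_divide add_divide_distrib del: of_nat_Suc)
    with main[of K] show ?case by (simp only: Re_divide_of_nat) simp
  qed
  ultimately have "0 \<le> Re (of_real (1 ^ card G) * A + S)"
    by (intro tendsto_lowerbound) auto
  then show ?thesis by (simp add: A_def S_def)
qed

subsection \<open>Positive semidefinite matrices\<close>

lemma quad_form_pair:
  fixes M :: "nat \<Rightarrow> nat \<Rightarrow> complex" and a b :: complex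
  assumes "i < n" "j < n" "i \<noteq> j"
  defines "v \<equiv> \<lambda>k :: nat. if k = i then a else if k = j then b else 0"
  shows "(\<Sum>k<n. \<Sum>l<n. cnj (v k) * M k l * v l)
    = cnj a * M i i * a + cnj a * M i j * b + cnj b * M j i * a + cnj b * M j j * b"
proof -
  have inner: "(\<Sum>l<n. cnj (v k) * M k l * v l) = (\<Sum>l\<in>{i, j}. cnj (v k) * M k l * v l)" for k
    using assms(1,2) by (intro sum.mono_neutral_right) (auto simp: v_def)
  have "(\<Sum>k<n. \<Sum>l<n. cnj (v k) * M k l * v l) = (\<Sum>k\<in>{i, j}. \<Sum>l\<in>{i, j}. cnj (v k) * M k l * v l)"
    unfolding inner using assms(1,2) by (intro sum.mono_neutral_right) (auto simp: v_def)
  then show ?thesis using assms(3) by (simp add: v_def algebra_simps)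
qed

lemma psd_pair:
  assumes "psd n M" "i < n" "j < n" "i \<noteq> j"
  shows "cnj a * M i i * a + cnj a * M i j * b + cnj b * M j i * a + cnj b * M j j * b \<in> \<real>"
    and "0 \<le> Re (cnj a * M i i * a + cnj a * M i j * b + cnj b * M j i * a + cnj b * M j j * b)"
  using assms(1)[unfolded psd_def, THEN spec, of "\<lambda>k. if k = i then a else if k = j then b else 0"]
  unfolding quad_form_pair[OF assms(2-4)] by - (erule conjunct1, erule conjunct2)

lemma psd_diag:
  assumes "psd n M" "i < n"
  shows "M i i \<in> \<real>" "0 \<le> Re (M i i)"
proof -
  have inner: "(\<Sum>l<n. cnj (if k = i then 1 else 0) * M k l * (if l = i then 1 else 0))
    = (\<Sum>l\<in>{i}. cnj (if k = i then 1 else 0) * M k l * (if l = i then 1 else 0))" for k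
    using assms(2) by (intro sum.mono_neutral_right) auto
  have "(\<Sum>k<n. \<Sum>l<n. cnj (if k = i then 1 else 0) * M k l * (if l = i then 1 else 0))
    = (\<Sum>k\<in>{i}. \<Sum>l\<in>{i}. cnj (if k = i then 1 else 0) * M k l * (if l = i then 1 else 0))"
    unfolding inner using assms(2) by (intro sum.mono_neutral_right) auto
  then have "(\<Sum>k<n. \<Sum>l<n. cnj (if k = i then 1 else 0) * M k l * (if l = i then 1 else 0)) = M i i"
    by simp
  then show "M i i \<in> \<real>" "0 \<le> Re (M i i)"
    using assms(1)[unfolded psd_def, THEN spec, of "\<lambda>k. if k = i then 1 else 0"] by simp_all
qed

text \<open>Polarisation: reality of the form at the vectors with entries \<open>(1, 1)\<close> and
  \<open>(1, \<i>)\<close> in positions \<open>i\<close> and \<open>j\<close> gives opposite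
  imaginary and equal real parts.\<close>

lemma psd_hermitian:
  assumes "psd n M" "i < n" "j < n"
  shows "M j i = cnj (M i j)"
proof (cases "i = j")
  case True
  then show ?thesis using psd_diag(1)[OF assms(1,2)] by (simp add: Reals_cnj_iff)
next
  case False
  note d = psd_diag(1)[OF assms(1,2)] psd_diag(1)[OF assms(1,3)]
  show ?thesis
    using psd_pair(1)[OF assms False, of 1 1] psd_pair(1)[OF assms False, of 1 \<i>] d
    by (simp add: complex_eq_iff complex_is_Real_iff)
qed

text \<open>Otherwise entry 1 at \<open>i\<close> and a large negative multiple of
  \<open>cnj (M i j)\<close> at \<open>j\<close> would make the form negative.\<close>

lemma psd_zero_diag:
  assumes "psd n M" "i < n" "j < n" "M j j = 0"
  shows "M i j = 0"
proof (rule ccontr)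
  assume nz: "M i j \<noteq> 0"
  with assms(4) have ne: "i \<noteq> j" by auto
  define c where "c = (cmod (M i j))\<^sup>2"
  \<comment> \<open>Chosen so that \<open>2 * t * c = 2 * Re (M i i) + 2\<close>, which turns the
    value of the form into \<open>- Re (M i i) - 2\<close>.\<close>
  define t where "t = (Re (M i i) + 1) / c"
  have c: "c > 0" using nz by (simp add: c_def)
  have "0 \<le> Re (M i i + M i j * (- (of_real t * cnj (M i j))) + cnj (- (of_real t * cnj (M i j))) * M j i)"
    using psd_pair(2)[OF assms(1-3) ne, of 1 "- (of_real t * cnj (M i j))"] assms(4) by simp
  also have "M i j * (- (of_real t * cnj (M i j))) + cnj (- (of_real t * cnj (M i j))) * M j i = - of_real (2 * t * c)"
  proof -
    have "M i j * (- (of_real t * cnj (M i j))) + cnj (- (of_real t * cnj (M i j))) * M j i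
      = - of_real (2 * t) * (M i j * cnj (M i j))"
      unfolding psd_hermitian[OF assms(1-3)] by (simp add: algebra_simps)
    also have "M i j * cnj (M i j) = of_real c" by (simp only: c_def complex_norm_square)
    finally show ?thesis by simp
  qed
  then have "Re (M i i + M i j * (- (of_real t * cnj (M i j))) + cnj (- (of_real t * cnj (M i j))) * M j i)
    = Re (M i i) - 2 * t * c" by (simp only: add.assoc) simp
  also have "\<dots> = - Re (M i i) - 2" using c by (simp add: t_def)
  also have "\<dots> < 0" using psd_diag(2)[OF assms(1,2)] by simp
  finally show False by simp
qed

text \<open>Cholesky factorisation by induction: the last row and column are split off, and the
  Schur complement is again positive semidefinite.\<close>

lemma psd_gram:
  assumes "psd n M"
  shows "\<exists>u. \<forall>i<n. \<forall>j<n. M i j = (\<Sum>l<n. cnj (u l i) * u l j)"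
  using assms
proof (induction n arbitrary: M)
  case 0
  then show ?case by simp
next
  case (Suc n M)
  define d where "d = Re (M n n)"
  have Mnn: "M n n = of_real d" and d0: "d \<ge> 0"
    using psd_diag[OF Suc.prems, of n] by (auto simp: d_def complex_is_Real_iff complex_eq_iff)
  have herm: "M i n = cnj (M n i)" if "i < Suc n" for i
    using psd_hermitian[OF Suc.prems, of n i] that by simp
  \<comment> \<open>The Schur complement of the last diagonal entry. If \<open>d = 0\<close>,
    division by zero leaves \<open>M\<close> unchanged, and the last row and column vanish by
    \<open>psd_zero_diag\<close>.\<close>
  define M' where "M' i j = M i j - cnj (M n i) * M n j / of_real d" for i j
  have "psd n M'"
    unfolding psd_def
  proof
    fix v :: "nat \<Rightarrow> complex"
    define s where "s = (\<Sum>j<n. M n j * v j)"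
    \<comment> \<open>The last coordinate that completes the square, so that the form of
      \<open>M\<close> at \<open>w\<close> equals that of \<open>M'\<close> at
      \<open>v\<close>.\<close>
    define t where "t = - s / of_real d"
    define w where "w k = (if k = n then t else v k)" for k
    have s0: "s = 0" if "d = 0"
      unfolding s_def
    proof (intro sum.neutral ballI)
      fix j assume "j \<in> {..<n}"
      then have "M j n = 0" using psd_zero_diag[OF Suc.prems, of j n] Mnn that by simp
      then show "M n j * v j = 0" using herm[of j] \<open>j \<in> {..<n}\<close> by simp
    qed
    have cs: "(\<Sum>i<n. cnj (v i) * M i n) = cnj s"
      by (simp add: s_def herm mult.commute)
    have ss: "cnj s * s / of_real d = (\<Sum>i<n. \<Sum>j<n. cnj (M n i * v i) * (M n j * v j) / of_real d)"
      by (simp only: s_def cnj_sum sum_product sum_divide_distrib)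
    have "(\<Sum>i<Suc n. \<Sum>j<Suc n. cnj (w i) * M i j * w j)
      = (\<Sum>i<n. (\<Sum>j<n. cnj (v i) * M i j * v j) + cnj (v i) * M i n * t)
        + ((\<Sum>j<n. cnj t * M n j * v j) + cnj t * M n n * t)"
      by (simp add: w_def)
    also have "\<dots> = (\<Sum>i<n. \<Sum>j<n. cnj (v i) * M i j * v j) + (\<Sum>i<n. cnj (v i) * M i n) * t + cnj t * s + cnj t * of_real d * t"
      by (simp add: s_def sum.distrib sum_distrib_left sum_distrib_right Mnn mult_ac)
    also have "\<dots> = (\<Sum>i<n. \<Sum>j<n. cnj (v i) * M i j * v j) - cnj s * s / of_real d"
      unfolding cs using s0 by (cases "d = 0") (auto simp: t_def field_simps)
    also have "\<dots> = (\<Sum>i<n. \<Sum>j<n. cnj (v i) * M' i j * v j)"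
      unfolding ss M'_def sum_subtractf[symmetric]
      by (intro sum.cong refl) (simp add: algebra_simps)
    finally have "(\<Sum>i<n. \<Sum>j<n. cnj (v i) * M' i j * v j) = (\<Sum>i<Suc n. \<Sum>j<Suc n. cnj (w i) * M i j * w j)" ..
    then show "(\<Sum>i<n. \<Sum>j<n. cnj (v i) * M' i j * v j) \<in> \<real> \<and> 0 \<le> Re (\<Sum>i<n. \<Sum>j<n. cnj (v i) * M' i j * v j)"
      using Suc.prems[unfolded psd_def, THEN spec, of w] by simp
  qed
  from Suc.IH[OF this] obtain u where u: "\<And>i j. i < n \<Longrightarrow> j < n \<Longrightarrow> M' i j = (\<Sum>l<n. cnj (u l i) * u l j)"
    by blast
  \<comment> \<open>One new Gram coordinate carries the split-off row; the last party has only this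
    coordinate.\<close>
  define u' where "u' l j = (if l = n then M n j / of_real (sqrt d) else if j = n then 0 else u l j)" for l j
  have last: "cnj (u' n i) * u' n j = cnj (M n i) * M n j / of_real d" for i j
    using d0 by (simp add: u'_def flip: of_real_mult)
  have "M i j = (\<Sum>l<Suc n. cnj (u' l i) * u' l j)" if ij: "i < Suc n" "j < Suc n" for i j
  proof (cases "i < n \<and> j < n")
    case True
    then have "(\<Sum>l<Suc n. cnj (u' l i) * u' l j) = M' i j + cnj (M n i) * M n j / of_real d"
      using u[of i j] by (simp add: last) (simp add: u'_def)
    then show ?thesis by (simp add: M'_def)
  next
    case False
    then have n: "i = n \<or> j = n" using ij by auto
    then have "(\<Sum>l<n. cnj (u' l i) * u' l j) = 0"
      by (intro sum.neutral) (auto simp: u'_def)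
    then have "(\<Sum>l<Suc n. cnj (u' l i) * u' l j) = cnj (M n i) * M n j / of_real d"
      by (simp add: last)
    also have "\<dots> = M i j"
    proof (cases "d = 0")
      case True
      then have z: "M k n = 0" if "k < Suc n" for k
        using psd_zero_diag[OF Suc.prems that, of n] Mnn by simp
      then have "M n k = 0" if "k < Suc n" for k using herm[OF that] that by simp
      with z n ij True show ?thesis by auto
    next
      case False
      with n Mnn herm[OF ij(1)] show ?thesis by auto
    qed
    finally show ?thesis ..
  qed
  then show ?case by blast
qed

lemma psd_gram_matrix:
  "psd n (\<lambda>i j. \<Sum>l<(r::nat). cnj (u l i) * u l j)"
  unfolding psd_def
proof
  fix v :: "nat \<Rightarrow> complex"
  have "(\<Sum>i<n. \<Sum>j<n. cnj (v i) * (\<Sum>l<r. cnj (u l i) * u l j) * v j)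
    = (\<Sum>i<n. \<Sum>j<n. \<Sum>l<r. cnj (u l i * v i) * (u l j * v j))"
    by (simp add: sum_distrib_left sum_distrib_right mult_ac)
  also have "\<dots> = (\<Sum>i<n. \<Sum>l<r. \<Sum>j<n. cnj (u l i * v i) * (u l j * v j))"
    by (rule sum.cong[OF refl]) (rule sum.swap)
  also have "\<dots> = (\<Sum>l<r. \<Sum>i<n. \<Sum>j<n. cnj (u l i * v i) * (u l j * v j))"
    by (rule sum.swap)
  also have "\<dots> = (\<Sum>l<r. of_real ((cmod (\<Sum>j<n. u l j * v j))\<^sup>2))"
  proof -
    have "of_real ((cmod z)\<^sup>2) = cnj z * z" for z
      by (simp only: complex_norm_square mult.commute)
    then show ?thesis by (simp only: cnj_sum sum_product)
  qed
  also have "\<dots> = of_real (\<Sum>l<r. (cmod (\<Sum>j<n. u l j * v j))\<^sup>2)" by simp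
  finally have *: "(\<Sum>i<n. \<Sum>j<n. cnj (v i) * (\<Sum>l<r. cnj (u l i) * u l j) * v j)
    = of_real (\<Sum>l<r. (cmod (\<Sum>j<n. u l j * v j))\<^sup>2)" .
  show "(\<Sum>i<n. \<Sum>j<n. cnj (v i) * (\<Sum>l<r. cnj (u l i) * u l j) * v j) \<in> \<real> \<and>
    0 \<le> Re (\<Sum>i<n. \<Sum>j<n. cnj (v i) * (\<Sum>l<r. cnj (u l i) * u l j) * v j)"
    unfolding * by (auto intro: sum_nonneg)
qed

lemma psd_scale_add:
  fixes c d :: real
  assumes "psd n M" "psd n N" "c \<ge> 0" "d \<ge> 0"
  shows "psd n (\<lambda>i j. of_real c * M i j + of_real d * N i j)"
  unfolding psd_def
proof
  fix v :: "nat \<Rightarrow> complex"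
  have "(\<Sum>i<n. \<Sum>j<n. cnj (v i) * (of_real c * M i j + of_real d * N i j) * v j)
     = of_real c * (\<Sum>i<n. \<Sum>j<n. cnj (v i) * M i j * v j) + of_real d * (\<Sum>i<n. \<Sum>j<n. cnj (v i) * N i j * v j)"
    by (simp add: sum_distrib_left sum.distrib algebra_simps)
  then show "(\<Sum>i<n. \<Sum>j<n. cnj (v i) * (of_real c * M i j + of_real d * N i j) * v j) \<in> \<real> \<and>
    0 \<le> Re (\<Sum>i<n. \<Sum>j<n. cnj (v i) * (of_real c * M i j + of_real d * N i j) * v j)"
    using assms unfolding psd_def by auto
qed

subsection \<open>The nearest decomposable matrix\<close>

definition feasible :: "nat \<Rightarrow> nat \<Rightarrow> (nat \<Rightarrow> nat \<Rightarrow> bool) \<Rightarrow> (nat \<Rightarrow> nat \<Rightarrow> nat \<Rightarrow> complex) \<Rightarrow> bool" where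
  "feasible m n adj Q \<longleftrightarrow> (\<forall>al<m. psd n (Q al) \<and>
     (\<forall>i<n. \<forall>j<n. Q al i j \<noteq> 0 \<longrightarrow> adj al i \<and> adj al j))"

text \<open>For a feasible \<open>Q\<close> in an NDCS network, this is the squared Frobenius
  distance from \<open>C\<close> to the sum of the \<open>Q al\<close>, restricted to the diagonal
  and to pairs with a common source. Off the diagonal only one source contributes to an entry, so
  the comparison is made source by source.\<close>

definition gap :: "nat \<Rightarrow> nat \<Rightarrow> (nat \<Rightarrow> nat \<Rightarrow> bool) \<Rightarrow> (nat \<Rightarrow> nat \<Rightarrow> complex) \<Rightarrow>
    (nat \<Rightarrow> nat \<Rightarrow> nat \<Rightarrow> complex) \<Rightarrow> real" where
  "gap m n adj C Q = (\<Sum>(al, i, j)\<in>off_diag m n adj. (cmod (Q al i j - C i j))\<^sup>2)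
     + (\<Sum>i<n. (cmod ((\<Sum>al<m. Q al i i) - C i i))\<^sup>2)"

text \<open>Up to the factor 2, the gradient of \<^const>\<open>gap\<close> with respect to the bilinear \<open>pairing\<close> below. Its diagonal
  entries do not depend on the source.\<close>

definition gap_dual :: "nat \<Rightarrow> (nat \<Rightarrow> nat \<Rightarrow> bool) \<Rightarrow> (nat \<Rightarrow> nat \<Rightarrow> complex) \<Rightarrow>
    (nat \<Rightarrow> nat \<Rightarrow> nat \<Rightarrow> complex) \<Rightarrow> nat \<Rightarrow> nat \<Rightarrow> nat \<Rightarrow> complex" where
  "gap_dual m adj C Q al i j = (if adj al i \<and> adj al j
     then cnj (if i = j then (\<Sum>be<m. Q be i i) - C i i else Q al i j - C i j) else 0)"

definition pairing :: "nat \<Rightarrow> nat \<Rightarrow> (nat \<Rightarrow> nat \<Rightarrow> nat \<Rightarrow> complex) \<Rightarrow>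
    (nat \<Rightarrow> nat \<Rightarrow> nat \<Rightarrow> complex) \<Rightarrow> complex" where
  "pairing m n T V = (\<Sum>al<m. \<Sum>i<n. \<Sum>j<n. T al i j * V al i j)"

lemma gap_nonneg: "0 \<le> gap m n adj C Q"
  unfolding gap_def by (intro add_nonneg_nonneg sum_nonneg) auto

text \<open>Because the diagonal of \<open>gap_dual\<close> is the same at all adjacent sources, the
  diagonal of \<open>V\<close> enters only through its sum over sources, as it does in
  \<open>gap\<close>.\<close>

lemma pairing_gap_dual:
  assumes V: "\<And>al i. al < m \<Longrightarrow> i < n \<Longrightarrow> V al i i \<noteq> 0 \<Longrightarrow> adj al i"
  shows "pairing m n (gap_dual m adj C Q) V
    = (\<Sum>(al, i, j)\<in>off_diag m n adj. cnj (Q al i j - C i j) * V al i j)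
      + (\<Sum>i<n. cnj ((\<Sum>al<m. Q al i i) - C i i) * (\<Sum>al<m. V al i i))"
proof -
  define g where "g al i j = gap_dual m adj C Q al i j * V al i j" for al i j
  have "pairing m n (gap_dual m adj C Q) V = (\<Sum>i<n. \<Sum>al<m. \<Sum>j<n. g al i j)"
    unfolding pairing_def g_def by (rule sum.swap)
  also have "\<dots> = (\<Sum>i<n. \<Sum>j<n. \<Sum>al<m. g al i j)"
    by (rule sum.cong[OF refl]) (rule sum.swap)
  also have "\<dots> = (\<Sum>i<n. (\<Sum>al<m. g al i i) + (\<Sum>j\<in>{..<n}-{i}. \<Sum>al<m. g al i j))"
    by (rule sum.cong[OF refl]) (simp add: sum.remove)
  also have "\<dots> = (\<Sum>i<n. \<Sum>al<m. g al i i) + (\<Sum>i<n. \<Sum>j\<in>{..<n}-{i}. \<Sum>al<m. g al i j)"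
    by (rule sum.distrib)
  also have "(\<Sum>i<n. \<Sum>j\<in>{..<n}-{i}. \<Sum>al<m. g al i j)
      = (\<Sum>i<n. \<Sum>j\<in>{..<n}-{i}. \<Sum>al | al < m \<and> adj al i \<and> adj al j. g al i j)"
    by (rule sum.cong[OF refl], rule sum.cong[OF refl], rule sum.mono_neutral_right)
      (auto simp: g_def gap_dual_def)
  also have "\<dots> = (\<Sum>(al, i, j)\<in>off_diag m n adj. g al i j)"
    by (rule sum_off_diag[symmetric])
  also have "\<dots> = (\<Sum>(al, i, j)\<in>off_diag m n adj. cnj (Q al i j - C i j) * V al i j)"
    by (rule sum.cong[OF refl]) (auto simp: off_diag_def g_def gap_dual_def)
  also have "(\<Sum>i<n. \<Sum>al<m. g al i i) = (\<Sum>i<n. cnj ((\<Sum>al<m. Q al i i) - C i i) * (\<Sum>al<m. V al i i))"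
    unfolding sum_distrib_left using V
    by (intro sum.cong refl) (auto simp: g_def gap_dual_def)
  finally show ?thesis by (simp only: add.commute)
qed

lemma cmod_add_real_multiple_sq:
  "(cmod (a + of_real t * b))\<^sup>2 = (cmod a)\<^sup>2 + 2 * t * Re (cnj a * b) + t\<^sup>2 * (cmod b)\<^sup>2"
  unfolding cmod_power2 by (simp add: power2_eq_square algebra_simps)

lemma sum_cmod_add_real_multiple_sq:
  "(\<Sum>x\<in>X. (cmod (a x + of_real t * b x))\<^sup>2)
    = (\<Sum>x\<in>X. (cmod (a x))\<^sup>2) + 2 * t * Re (\<Sum>x\<in>X. cnj (a x) * b x) + t\<^sup>2 * (\<Sum>x\<in>X. (cmod (b x))\<^sup>2)"
  by (simp only: cmod_add_real_multiple_sq sum.distrib sum_distrib_left Re_sum)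

text \<open>Along a line \<open>gap\<close> is exactly quadratic; the leading coefficient is
  \<open>gap\<close> with target 0, and only the linear one matters for the first-order
  conditions.\<close>

lemma gap_expand:
  assumes V: "\<And>al i. al < m \<Longrightarrow> i < n \<Longrightarrow> V al i i \<noteq> 0 \<Longrightarrow> adj al i"
  shows "gap m n adj C (\<lambda>al i j. Q al i j + of_real t * V al i j)
    = gap m n adj C Q + 2 * t * Re (pairing m n (gap_dual m adj C Q) V) + t\<^sup>2 * gap m n adj (\<lambda>_ _. 0) V"
proof -
  have 1: "Q al i j + of_real t * V al i j - C i j = (Q al i j - C i j) + of_real t * V al i j" for al i j
    by simp
  have 2: "(\<Sum>al<m. Q al i i + of_real t * V al i i) - C i i
      = ((\<Sum>al<m. Q al i i) - C i i) + of_real t * (\<Sum>al<m. V al i i)" for i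
    by (simp add: sum.distrib sum_distrib_left)
  have 3: "pairing m n (gap_dual m adj C Q) V
    = (\<Sum>(al, i, j)\<in>off_diag m n adj. cnj (Q al i j - C i j) * V al i j)
      + (\<Sum>i<n. cnj ((\<Sum>al<m. Q al i i) - C i i) * (\<Sum>al<m. V al i i))"
    by (rule pairing_gap_dual) (rule V)
  show ?thesis
    unfolding gap_def 3 1 2 split_def sum_cmod_add_real_multiple_sq
    by (simp only: plus_complex.sel diff_zero distrib_left add.assoc add.left_commute add.commute)
qed

lemma feasible_add:
  assumes "feasible m n adj Q" "feasible m n adj V" "t \<ge> 0"
  shows "feasible m n adj (\<lambda>al i j. Q al i j + of_real t * V al i j)"
  unfolding feasible_def
proof (intro allI impI conjI)
  fix al assume al: "al < m"
  show "psd n (\<lambda>i j. Q al i j + of_real t * V al i j)"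
    using psd_scale_add[of n "Q al" "V al" 1 t] assms al unfolding feasible_def by simp
  fix i j assume ij: "i < n" "j < n" "Q al i j + of_real t * V al i j \<noteq> 0"
  then have "Q al i j \<noteq> 0 \<or> V al i j \<noteq> 0" by auto
  then show "adj al i" "adj al j" using assms(1,2) al ij(1,2) unfolding feasible_def by blast+
qed

text \<open>Written as the addition of a negative multiple of \<open>Q\<close>, so that
  \<open>gap_expand\<close> applies with \<open>V = Q\<close>.\<close>

lemma feasible_shrink:
  assumes "feasible m n adj Q" "0 \<le> t" "t \<le> 1"
  shows "feasible m n adj (\<lambda>al i j. Q al i j + of_real (- t) * Q al i j)"
proof -
  have eq: "(\<lambda>i j. Q al i j + of_real (- t) * Q al i j) = (\<lambda>i j. of_real (1 - t) * Q al i j + of_real 0 * Q al i j)" for al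
    by (intro ext) (simp add: algebra_simps)
  have "psd n (\<lambda>i j. Q al i j + of_real (- t) * Q al i j)" if "al < m" for al
    unfolding eq using assms that by (intro psd_scale_add) (auto simp: feasible_def)
  then show ?thesis using assms(1) unfolding feasible_def by auto
qed

lemma nonneg_of_quadratic:
  fixes a b :: real
  assumes "\<And>t. 0 < t \<Longrightarrow> t \<le> 1 \<Longrightarrow> 0 \<le> 2 * t * a + t\<^sup>2 * b"
  shows "0 \<le> a"
proof (rule ccontr)
  assume "\<not> 0 \<le> a"
  \<comment> \<open>Small enough that \<open>t * b\<close> is at most \<open>- a\<close>, so the
    linear term decides the sign.\<close>
  define t where "t = min 1 (- a / (\<bar>b\<bar> + 1))"
  have t: "0 < t" "t \<le> 1" using \<open>\<not> 0 \<le> a\<close> by (auto simp: t_def divide_simps)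
  have "t * b \<le> t * (\<bar>b\<bar> + 1)" using t by (intro mult_left_mono) auto
  also have "\<dots> \<le> - a"
  proof -
    have "t \<le> - a / (\<bar>b\<bar> + 1)" unfolding t_def by (rule min.cobounded2)
    then show ?thesis by (subst (asm) pos_le_divide_eq) auto
  qed
  finally have "2 * a + t * b < 0" using \<open>\<not> 0 \<le> a\<close> by simp
  then have "t * (2 * a + t * b) < 0" using t by (simp add: mult_pos_neg)
  then show False using assms[OF t] by (simp add: power2_eq_square algebra_simps)
qed

section \<open>Existence of a minimiser\<close>

text \<open>\<open>b (al, l, i)\<close> is coordinate \<open>l\<close> of the Gram vector of party
  \<open>i\<close> at source \<open>al\<close>; \<open>n\<close> coordinates suffice by
  \<open>psd_gram\<close>. Zeroing the vectors of non-adjacent parties builds in the support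
  condition, so \<open>b\<close> ranges freely and the domain can be a box.\<close>

definition gram_family :: "nat \<Rightarrow> (nat \<Rightarrow> nat \<Rightarrow> bool) \<Rightarrow> (nat \<times> nat \<times> nat \<Rightarrow> complex) \<Rightarrow>
    nat \<Rightarrow> nat \<Rightarrow> nat \<Rightarrow> complex" where
  "gram_family n adj b al i j = (\<Sum>l<n. cnj (if adj al i then b (al, l, i) else 0)
      * (if adj al j then b (al, l, j) else 0))"

lemma feasible_gram_family: "feasible m n adj (gram_family n adj b)"
  unfolding feasible_def
proof (intro allI impI conjI)
  fix al
  show "psd n (gram_family n adj b al)"
    unfolding gram_family_def by (rule psd_gram_matrix)
  fix i j assume "gram_family n adj b al i j \<noteq> 0"
  then have "adj al i \<and> adj al j"
    unfolding gram_family_def by (rule contrapos_np) (auto intro!: sum.neutral)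
  then show "adj al i" "adj al j" by auto
qed

lemma continuous_on_gap_gram_family:
  "continuous_on S (\<lambda>b. gap m n adj C (gram_family n adj b))"
proof -
  have coord: "continuous_on S (\<lambda>b :: nat \<times> nat \<times> nat \<Rightarrow> complex. if P then b t else 0)" for P t
    by (cases P) (auto intro: continuous_on_subset[OF continuous_on_product_coordinates])
  show ?thesis
    unfolding gap_def gram_family_def split_def by (intro continuous_intros coord)
qed

text \<open>Tychonoff's theorem, as the topology on functions is the product topology.\<close>

lemma compact_box:
  "compact {b :: 'i \<Rightarrow> complex. \<forall>t. b t \<in> cball 0 K}"
proof -
  have "compactin (product_topology (\<lambda>_. euclidean) UNIV) (PiE UNIV (\<lambda>_::'i. cball (0::complex) K))"
    by (simp add: compactin_PiE)
  then show ?thesis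
    unfolding euclidean_product_topology by (simp add: PiE_def Pi_def)
qed

text \<open>Parametrising positive semidefinite matrices by Gram vectors, only boundedly large vectors can
  beat the zero family, so the minimum is attained by compactness.\<close>

lemma gap_minimiser:
  "\<exists>Q. feasible m n adj Q \<and> (\<forall>Q'. feasible m n adj Q' \<longrightarrow> gap m n adj C Q \<le> gap m n adj C Q')"
proof -
  define g0 where "g0 = gap m n adj C (\<lambda>_ _ _. 0)"
  \<comment> \<open>For families no worse than zero, \<open>sqrt g0 + cmod (C i i)\<close> bounds
    the summed diagonal at \<open>i\<close>. The added 1 gives \<open>K \<le> K\<^sup>2\<close>,
    which turns a bound on squared coordinates into one on coordinates.\<close>
  define K where "K = 1 + sqrt g0 + (\<Sum>i<n. cmod (C i i))"
  define box where "box = {b :: nat \<times> nat \<times> nat \<Rightarrow> complex. \<forall>t. b t \<in> cball 0 K}"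
  have g0: "g0 \<ge> 0" unfolding g0_def by (rule gap_nonneg)
  have K1: "K \<ge> 1" unfolding K_def using g0 by (simp add: sum_nonneg)
  have zero: "(\<lambda>_. 0) \<in> box" using K1 by (simp add: box_def)
  have "compact box" unfolding box_def by (rule compact_box)
  then have "\<exists>b\<in>box. \<forall>b'\<in>box. gap m n adj C (gram_family n adj b) \<le> gap m n adj C (gram_family n adj b')"
    by (rule continuous_attains_inf) (use zero continuous_on_gap_gram_family in auto)
  then obtain b where b: "b \<in> box"
    "\<And>b'. b' \<in> box \<Longrightarrow> gap m n adj C (gram_family n adj b) \<le> gap m n adj C (gram_family n adj b')"
    by blast
  have "gap m n adj C (gram_family n adj b) \<le> gap m n adj C Q'" if Q': "feasible m n adj Q'" for Q'
  proof (cases "gap m n adj C Q' \<le> g0")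
    case False
    have "gap m n adj C (gram_family n adj b) \<le> gap m n adj C (gram_family n adj (\<lambda>_. 0))"
      by (rule b(2)[OF zero])
    also have "gram_family n adj (\<lambda>_. 0) = (\<lambda>_ _ _. 0)"
      by (intro ext) (simp add: gram_family_def)
    finally show ?thesis using False by (simp add: g0_def)
  next
    case True
    have "\<exists>u. \<forall>i<n. \<forall>j<n. Q' al i j = (\<Sum>l<n. cnj (u l i) * u l j)" if "al < m" for al
      using Q' that by (intro psd_gram) (simp add: feasible_def)
    then obtain u where u: "\<And>al i j. al < m \<Longrightarrow> i < n \<Longrightarrow> j < n \<Longrightarrow>
        Q' al i j = (\<Sum>l<n. cnj (u al l i) * u al l j)"
      by metis
    define b' where "b' = (\<lambda>(al, l, i). if al < m \<and> l < n \<and> i < n then u al l i else 0)"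
    have eq: "gram_family n adj b' al i j = Q' al i j" if "al < m" "i < n" "j < n" for al i j
    proof (cases "adj al i \<and> adj al j")
      case True
      then show ?thesis using that by (simp add: gram_family_def b'_def u)
    next
      case False
      then have "Q' al i j = 0" using Q' that unfolding feasible_def by blast
      moreover have "gram_family n adj b' al i j = 0"
        using False unfolding gram_family_def by (intro sum.neutral) auto
      ultimately show ?thesis by simp
    qed
    have "cmod (u al l i) \<le> K" if a: "al < m" "l < n" "i < n" for al l i
    proof -
      let ?q = "\<Sum>be<m. Q' be i i"
      have diag: "Re (Q' be i i) = (\<Sum>k<n. (cmod (u be k i))\<^sup>2)" if "be < m" for be
        using u[OF that a(3) a(3)] by (simp add: cmod_power2) (simp add: power2_eq_square)
      \<comment> \<open>Diagonal entries are nonnegative, so control of their sum over sources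
        controls each of them, and with it every Gram coordinate.\<close>
      have "(cmod (u al l i))\<^sup>2 \<le> (\<Sum>k<n. (cmod (u al k i))\<^sup>2)"
        using a by (intro member_le_sum) auto
      also have "\<dots> = Re (Q' al i i)" using diag a by simp
      also have "\<dots> \<le> (\<Sum>be<m. Re (Q' be i i))"
        using a by (intro member_le_sum) (auto simp: diag sum_nonneg)
      also have "\<dots> = Re ?q" by simp
      also have "\<dots> \<le> cmod ?q" by (rule complex_Re_le_cmod)
      also have "\<dots> \<le> cmod (?q - C i i) + cmod (C i i)"
        using norm_triangle_ineq[of "?q - C i i" "C i i"] by simp
      also have "cmod (?q - C i i) \<le> sqrt g0"
      proof (rule real_le_rsqrt)
        have "(cmod (?q - C i i))\<^sup>2 \<le> (\<Sum>i<n. (cmod ((\<Sum>al<m. Q' al i i) - C i i))\<^sup>2)"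
          using a by (intro member_le_sum) auto
        also have "\<dots> \<le> gap m n adj C Q'" unfolding gap_def by (simp add: sum_nonneg split_def)
        finally show "(cmod (?q - C i i))\<^sup>2 \<le> g0" using True by simp
      qed
      also have "cmod (C i i) \<le> (\<Sum>i<n. cmod (C i i))"
        using a by (intro member_le_sum) auto
      finally have "(cmod (u al l i))\<^sup>2 \<le> K" by (simp add: K_def)
      also have "K \<le> K\<^sup>2" using K1 by (simp add: power2_eq_square)
      finally show ?thesis using K1 by (simp add: power2_le_iff_abs_le)
    qed
    then have "b' \<in> box" using K1 by (auto simp: box_def b'_def)
    then have "gap m n adj C (gram_family n adj b) \<le> gap m n adj C (gram_family n adj b')" by (rule b(2))
    also have "\<dots> = gap m n adj C Q'"
      unfolding gap_def by (intro arg_cong2[where f = "(+)"] sum.cong refl) (auto simp: off_diag_def eq)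
    finally show ?thesis .
  qed
  then show ?thesis using feasible_gram_family by blast
qed

section \<open>First-order conditions and the vanishing of the gap\<close>

text \<open>Minimality makes each \<open>T al\<close> positive semidefinite and the pairing of
  \<open>T\<close> with \<open>Q\<close> at most 0, while the inflation inequality at the Gram
  vectors of \<open>T\<close> makes the corresponding pairing with \<open>C\<close> have nonnegative
  real part. The gap is the difference of the real parts, hence at most 0.\<close>

lemma (in inflation_form) minimal_gap_eq_0:
  assumes herm: "\<And>i j. i < n \<Longrightarrow> j < n \<Longrightarrow> C j i = cnj (C i j)"
    and source: "\<And>i. i < n \<Longrightarrow> \<exists>al<m. adj al i"
    and Q: "feasible m n adj Q"
    and Q_min: "\<And>Q'. feasible m n adj Q' \<Longrightarrow> gap m n adj C Q \<le> gap m n adj C Q'"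
  shows "gap m n adj C Q = 0"
proof -
  define T where "T = gap_dual m adj C Q"
  define y where "y i = Re ((\<Sum>al<m. Q al i i) - C i i)" for i
  have Q_psd: "psd n (Q al)" if "al < m" for al using Q that by (simp add: feasible_def)
  have supp: "adj al i" if "feasible m n adj V" "al < m" "i < n" "V al i i \<noteq> 0" for V al i
    using that unfolding feasible_def by blast
  have y: "(\<Sum>al<m. Q al i i) - C i i = of_real (y i)" if "i < n" for i
  proof -
    have "Im (Q al i i) = 0" if "al < m" for al
      using psd_diag(1)[OF Q_psd[OF that] \<open>i < n\<close>] by (simp add: complex_is_Real_iff)
    moreover have "Im (C i i) = 0"
      using arg_cong[OF herm[OF that that], of Im] by simp
    ultimately show ?thesis by (simp add: y_def complex_eq_iff)
  qed
  have T_diag: "T al i i = of_real (y i)" if "i < n" "adj al i" for al i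
    using that y by (simp add: T_def gap_dual_def)
  have T_herm: "T al j i = cnj (T al i j)" if "al < m" "i < n" "j < n" for al i j
  proof (cases "i = j")
    case True
    then show ?thesis using T_diag[OF that(2), of al] by (cases "adj al i") (auto simp: T_def gap_dual_def)
  next
    case False
    then show ?thesis
      using that herm[of i j] psd_hermitian[OF Q_psd, of al i j] by (simp add: T_def gap_dual_def)
  qed
  \<comment> \<open>Moving from \<open>Q\<close> in a feasible direction cannot lower the
    gap.\<close>
  have ascent: "0 \<le> Re (pairing m n T V)" if V: "feasible m n adj V" for V
  proof (rule nonneg_of_quadratic)
    fix t :: real assume t: "0 < t" "t \<le> 1"
    have "gap m n adj C Q \<le> gap m n adj C (\<lambda>al i j. Q al i j + of_real t * V al i j)"
      using t by (intro Q_min feasible_add Q V) simp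
    also have "\<dots> = gap m n adj C Q + 2 * t * Re (pairing m n T V) + t\<^sup>2 * gap m n adj (\<lambda>_ _. 0) V"
      unfolding T_def by (rule gap_expand) (rule supp[OF V])
    finally show "0 \<le> 2 * t * Re (pairing m n T V) + t\<^sup>2 * gap m n adj (\<lambda>_ _. 0) V" by simp
  qed
  \<comment> \<open>\<open>Q\<close> can also be moved towards 0, which gives the opposite sign in
    the direction \<open>Q\<close>.\<close>
  have "0 \<le> - Re (pairing m n T Q)"
  proof (rule nonneg_of_quadratic)
    fix t :: real assume t: "0 < t" "t \<le> 1"
    have "gap m n adj C Q \<le> gap m n adj C (\<lambda>al i j. Q al i j + of_real (- t) * Q al i j)"
      using t by (intro Q_min feasible_shrink Q) simp_all
    also have "\<dots> = gap m n adj C Q + 2 * (- t) * Re (pairing m n T Q) + (- t)\<^sup>2 * gap m n adj (\<lambda>_ _. 0) Q"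
      unfolding T_def by (rule gap_expand) (rule supp[OF Q])
    finally show "0 \<le> 2 * t * (- Re (pairing m n T Q)) + t\<^sup>2 * gap m n adj (\<lambda>_ _. 0) Q" by simp
  qed
  then have descent: "Re (pairing m n T Q) \<le> 0" by simp
  \<comment> \<open>Self-duality of the semidefinite cone: \<open>ascent\<close> is tested on
    rank-one families at the single source \<open>al\<close>. Cutting \<open>v\<close> down to the
    adjacent parties makes them feasible and keeps the form, since \<open>T al\<close> vanishes
    elsewhere.\<close>
  have T_psd: "psd n (T al)" if al: "al < m" for al
    unfolding psd_def
  proof
    fix v :: "nat \<Rightarrow> complex"
    define w where "w i = (if adj al i then v i else 0)" for i
    define V where "V be i j = (if be = al then cnj (w i) * w j else 0)" for be i j
    let ?q = "\<Sum>i<n. \<Sum>j<n. cnj (v i) * T al i j * v j"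
    have "psd n (V be)" for be
    proof (cases "be = al")
      case True
      have "V be = (\<lambda>i j. \<Sum>l<1::nat. cnj (w i) * w j)" using True by (intro ext) (simp add: V_def)
      then show ?thesis using psd_gram_matrix[of n "\<lambda>_. w" 1] by simp
    next
      case False
      then have "V be = (\<lambda>i j. \<Sum>l<0::nat. cnj (w i) * w j)" by (intro ext) (simp add: V_def)
      then show ?thesis using psd_gram_matrix[of n "\<lambda>_. w" 0] by simp
    qed
    then have "feasible m n adj V"
      unfolding feasible_def by (auto simp: V_def w_def split: if_splits)
    then have "0 \<le> Re (pairing m n T V)" by (rule ascent)
    also have "pairing m n T V = (\<Sum>be\<in>{al}. \<Sum>i<n. \<Sum>j<n. T be i j * V be i j)"
      unfolding pairing_def using al by (intro sum.mono_neutral_right) (auto simp: V_def)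
    also have "\<dots> = (\<Sum>i<n. \<Sum>j<n. T al i j * V al i j)" by simp
    also have "\<dots> = ?q"
      by (intro sum.cong refl) (simp add: V_def w_def T_def gap_dual_def)
    finally have nonneg: "0 \<le> Re ?q" .
    have "cnj ?q = (\<Sum>i<n. \<Sum>j<n. cnj (v j) * T al j i * v i)"
      unfolding cnj_sum by (intro sum.cong refl) (simp add: T_herm[OF al, symmetric] mult_ac)
    also have "\<dots> = ?q" by (rule sum.swap)
    finally have "?q \<in> \<real>" by (simp add: Reals_cnj_iff)
    with nonneg show "?q \<in> \<real> \<and> 0 \<le> Re ?q" by blast
  qed
  have "\<exists>u. \<forall>i<n. \<forall>j<n. T al i j = (\<Sum>l<n. cnj (u l i) * u l j)" if "al < m" for al
    using T_psd[OF that] by (rule psd_gram)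
  then obtain u where u: "\<And>al i j. al < m \<Longrightarrow> i < n \<Longrightarrow> j < n \<Longrightarrow>
      T al i j = (\<Sum>l<n. cnj (u al l i) * u al l j)"
    by metis
  have y_nonneg: "0 \<le> y i" if i: "i < n" for i
  proof -
    obtain al where "al < m" "adj al i" using source[OF i] by blast
    then show ?thesis using psd_diag(2)[OF T_psd i, of al] T_diag[OF i] by simp
  qed
  \<comment> \<open>The cut-off at \<open>n\<close> supplies the nonnegativity that
    \<open>gram_nonneg\<close> requires at every index.\<close>
  have "0 \<le> Re ((\<Sum>i<n. C i i * of_real (if i < n then y i else 0))
      + (\<Sum>(al, i, j)\<in>off_diag m n adj. C i j * (\<Sum>l<n. cnj (u al l i) * u al l j)))"
  proof (rule gram_nonneg)
    fix al i assume a: "al < m" "i < n" "adj al i"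
    \<comment> \<open>The source-independent diagonal of \<open>T\<close> gives the Gram vectors of
      a party the same norm at all its sources, as embezzlement with one vector per party
      demands.\<close>
    have "complex_of_real (\<Sum>l<n. (cmod (u al l i))\<^sup>2) = of_real (y i)"
      using u[OF a(1) a(2) a(2)] T_diag[OF a(2,3)]
      by (simp add: complex_norm_square[symmetric] mult.commute[of "cnj _"] del: of_real_power)
    then have "(\<Sum>l<n. (cmod (u al l i))\<^sup>2) = y i" by (simp only: of_real_eq_iff)
    then show "(\<Sum>l<n. (cmod (u al l i))\<^sup>2) \<le> (if i < n then y i else 0)" using a by simp
  qed (use y_nonneg in simp)
  also have "(\<Sum>i<n. C i i * of_real (if i < n then y i else 0)) = (\<Sum>i<n. of_real (y i) * C i i)"
    by (intro sum.cong refl) simp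
  also have "(\<Sum>(al, i, j)\<in>off_diag m n adj. C i j * (\<Sum>l<n. cnj (u al l i) * u al l j))
      = (\<Sum>(al, i, j)\<in>off_diag m n adj. cnj (Q al i j - C i j) * C i j)"
  proof (rule sum.cong[OF refl], clarify)
    fix al i j assume "(al, i, j) \<in> off_diag m n adj"
    then have "al < m" "i < n" "j < n" "T al i j = cnj (Q al i j - C i j)"
      by (auto simp: off_diag_def T_def gap_dual_def)
    then show "C i j * (\<Sum>l<n. cnj (u al l i) * u al l j) = cnj (Q al i j - C i j) * C i j"
      using u[of al i j] by simp
  qed
  finally have dual_value: "0 \<le> Re ((\<Sum>i<n. of_real (y i) * C i i)
      + (\<Sum>(al, i, j)\<in>off_diag m n adj. cnj (Q al i j - C i j) * C i j))" .
  \<comment> \<open>Writing \<open>Q\<close> as \<open>(Q - C) + C\<close> in each term separates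
    the gap from the dual value just bounded.\<close>
  have "pairing m n T Q = (\<Sum>(al, i, j)\<in>off_diag m n adj. cnj (Q al i j - C i j) * Q al i j)
      + (\<Sum>i<n. cnj ((\<Sum>al<m. Q al i i) - C i i) * (\<Sum>al<m. Q al i i))"
    unfolding T_def by (rule pairing_gap_dual) (rule supp[OF Q])
  also have "(\<Sum>i<n. cnj ((\<Sum>al<m. Q al i i) - C i i) * (\<Sum>al<m. Q al i i))
      = (\<Sum>i<n. of_real ((cmod ((\<Sum>al<m. Q al i i) - C i i))\<^sup>2) + of_real (y i) * C i i)"
  proof (rule sum.cong[OF refl])
    fix i assume "i \<in> {..<n}"
    then have "y i = (\<Sum>al<m. Q al i i) - C i i" using y by simp
    then show "cnj ((\<Sum>al<m. Q al i i) - C i i) * (\<Sum>al<m. Q al i i)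
      = of_real ((cmod ((\<Sum>al<m. Q al i i) - C i i))\<^sup>2) + of_real (y i) * C i i"
      by (metis (no_types, lifting) add.commute complex_cnj_complex_of_real complex_norm_square diff_add_cancel
          distrib_left)
  qed
  also have "(\<Sum>(al, i, j)\<in>off_diag m n adj. cnj (Q al i j - C i j) * Q al i j)
      = (\<Sum>(al, i, j)\<in>off_diag m n adj. of_real ((cmod (Q al i j - C i j))\<^sup>2) + cnj (Q al i j - C i j) * C i j)"
    unfolding complex_norm_square by (intro sum.cong refl) (auto simp: algebra_simps)
  finally have "pairing m n T Q = of_real (gap m n adj C Q) + ((\<Sum>i<n. of_real (y i) * C i i)
      + (\<Sum>(al, i, j)\<in>off_diag m n adj. cnj (Q al i j - C i j) * C i j))"
    by (simp add: gap_def split_def sum.distrib del: of_real_power)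
  with descent dual_value have "gap m n adj C Q \<le> 0" by simp
  with gap_nonneg[of m n adj C Q] show ?thesis by simp
qed

text \<open>The minimiser itself is the decomposition: zero gap matches the diagonal and every entry
  at its unique common source, and the remaining entries of \<open>C\<close> and of the sum are
  zero.\<close>

lemma (in inflation_form) N_compatible_decomp_of_psd:
  assumes ndcs: "NDCS m n adj" and psd: "psd n C"
    and indep: "\<And>i j. i < n \<Longrightarrow> j < n \<Longrightarrow> i \<noteq> j \<Longrightarrow> \<not> (\<exists>al<m. adj al i \<and> adj al j) \<Longrightarrow> C i j = 0"
  shows "N_compatible_decomp m n adj C"
proof -
  obtain Q where Q: "feasible m n adj Q"
    and Q_min: "\<And>Q'. feasible m n adj Q' \<Longrightarrow> gap m n adj C Q \<le> gap m n adj C Q'"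
    using gap_minimiser by blast
  have "gap m n adj C Q = 0"
  proof (rule minimal_gap_eq_0[OF _ _ Q Q_min])
    show "\<exists>al<m. adj al i" if "i < n" for i
      using ndcs that unfolding NDCS_def network_def by blast
  qed (rule psd_hermitian[OF psd])
  moreover have "0 \<le> (\<Sum>(al, i, j)\<in>off_diag m n adj. (cmod (Q al i j - C i j))\<^sup>2)"
    "0 \<le> (\<Sum>i<n. (cmod ((\<Sum>al<m. Q al i i) - C i i))\<^sup>2)"
    by (auto intro!: sum_nonneg)
  ultimately have "(\<Sum>(al, i, j)\<in>off_diag m n adj. (cmod (Q al i j - C i j))\<^sup>2) = 0"
    and "(\<Sum>i<n. (cmod ((\<Sum>al<m. Q al i i) - C i i))\<^sup>2) = 0"
    unfolding gap_def by linarith+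
  then have zero: "\<forall>x\<in>off_diag m n adj. (case x of (al, i, j) \<Rightarrow> (cmod (Q al i j - C i j))\<^sup>2) = 0"
    "\<forall>i\<in>{..<n}. (cmod ((\<Sum>al<m. Q al i i) - C i i))\<^sup>2 = 0"
    by (subst (asm) sum_nonneg_eq_0_iff; auto)+
  have off: "Q al i j = C i j" if "(al, i, j) \<in> off_diag m n adj" for al i j
    using bspec[OF zero(1) that] by simp
  have diag: "(\<Sum>al<m. Q al i i) = C i i" if "i < n" for i
    using zero(2) that by simp
  have Q_supp: "adj al i \<and> adj al j" if "al < m" "i < n" "j < n" "Q al i j \<noteq> 0" for al i j
    using Q that unfolding feasible_def by blast
  have "C i j = (\<Sum>al<m. Q al i j)" if ij: "i < n" "j < n" for i j
  proof (cases "i = j")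
    case True
    then show ?thesis using diag[OF ij(1)] by simp
  next
    case ne: False
    define S where "S = {al. al < m \<and> adj al i \<and> adj al j}"
    have finS: "finite S" by (simp add: S_def)
    have "(\<Sum>al<m. Q al i j) = (\<Sum>al\<in>S. Q al i j)"
      using Q_supp ij by (intro sum.mono_neutral_right) (auto simp: S_def)
    also have "\<dots> = (\<Sum>al\<in>S. C i j)"
      using off ij ne by (intro sum.cong refl) (auto simp: off_diag_def S_def)
    also have "\<dots> = C i j"
    proof (cases "\<exists>al<m. adj al i \<and> adj al j")
      case True
      then have "S \<noteq> {}" by (auto simp: S_def)
      moreover have "card S \<le> 1" using ndcs ij ne unfolding NDCS_def S_def by blast
      moreover have "card S \<noteq> 0" using finS \<open>S \<noteq> {}\<close> by simp
      ultimately have "card S = 1" by linarith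
      then show ?thesis by simp
    next
      case False
      then show ?thesis using indep[OF ij ne] by simp
    qed
    finally show ?thesis by simp
  qed
  then show ?thesis
    using Q unfolding N_compatible_decomp_def feasible_def by blast
qed

section \<open>Application to covariance matrices\<close>

lemma psd_cov_matrix:
  fixes p :: "(nat \<Rightarrow> 'a::finite) pmf"
  shows "psd n (cov_matrix p f)"
  unfolding psd_def
proof
  fix v :: "nat \<Rightarrow> complex"
  have "finite (range (\<lambda>x :: nat \<Rightarrow> 'a. f i (x i)))" for i
    by (rule finite_subset[of _ "range (f i)"]) auto
  then have "(\<Sum>i<n. \<Sum>j<n. cnj (v i) * cov_matrix p f i j * v j)
    = of_real (measure_pmf.expectation p (\<lambda>x. (cmod (\<Sum>j<n. v j *
        (f j (x j) - measure_pmf.expectation p (\<lambda>x. f j (x j)))))\<^sup>2))" (is "_ = of_real ?e")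
    unfolding cov_matrix_eq_cov by (rule cov_quad_form)
  moreover have "0 \<le> ?e" by (intro integral_nonneg_AE) auto
  ultimately show "(\<Sum>i<n. \<Sum>j<n. cnj (v i) * cov_matrix p f i j * v j) \<in> \<real> \<and>
    0 \<le> Re (\<Sum>i<n. \<Sum>j<n. cnj (v i) * cov_matrix p f i j * v j)"
    by simp
qed

theorem theorem1:
  fixes m n :: nat and adj :: "nat \<Rightarrow> nat \<Rightarrow> bool"
    and p :: "(nat \<Rightarrow> 'a::finite) pmf" and f :: "nat \<Rightarrow> 'a \<Rightarrow> complex"
  assumes "NDCS m n adj"
    and "causally_consistent_distr m n adj p"
  shows "psd n (cov_matrix p f) \<and> N_compatible_decomp m n adj (cov_matrix p f)"
proof
  interpret inflation_form m n adj "cov_matrix p f"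
    using assms by (rule inflation_form_cov_matrix)
  show psd: "psd n (cov_matrix p f)" by (rule psd_cov_matrix)
  show "N_compatible_decomp m n adj (cov_matrix p f)"
  proof (rule N_compatible_decomp_of_psd[OF assms(1) psd])
    fix i j assume ij: "i < n" "j < n" "i \<noteq> j" "\<not> (\<exists>al<m. adj al i \<and> adj al j)"
    \<comment> \<open>No triple of \<open>off_diag\<close> contains such a pair, so the form does
      not constrain this entry; C0 makes it vanish.\<close>
    have "indep_pair p (\<lambda>x. x i) (\<lambda>x. x j)"
      using assms(2) ij unfolding causally_consistent_distr_def causally_consistent_def by blast
    from cov_indep_pair[OF this, of "f i" "f j"] show "cov_matrix p f i j = 0"
      by (simp add: cov_matrix_eq_cov o_def)
  qed
qed

end
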